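(* Let $d\ge 2$. For every graph $G=(V,E)$ and every partition $V=A_1\cup\cdots\cup A_d$ with $A_i\neq\emptyset$ for all $i$, \[ a_d(G)\geq \min\left(\{a(G[A_i])\}_{1\leq i\leq d} \cup\left\{\tfrac{1}{2}a(G(A_i,A_j))\right\}_{1\leq i<j\leq d}\right). \] In particular, if $G[A_i]$ is connected for all $i\in[d]$ and $G(A_i,A_j)$ is connected for all $1\le i<j\le d$, then $G$ is $d$-rigid.
   Context: For a graph $G=(V,E)$ and $p:V\to\mathbb R^d$, let $d_{uv}=\frac{p(u)-p(v)}{\|p(u)-p(v)\|}$ if $p(u)\ne p(v)$ and $0$ otherwise; let $R(G,p)\in\mathbb R^{d|V|\times |E|}$ be the matrix whose columns are $(1_u-1_v)\otimes d_{uv}$ for $\{u,v\}\in E$, and $L(G,p)=R(G,p)R(G,p)^T$. With $\lambda_i$ the $i$-th smallest eigenvalue, $a_d(G)=\sup_{p:V\to\mathbb R^d}\lambda_{\binom{d+1}{2}+1}(L(G,p))$. $a(G)$ denotes the algebraic connectivity (second smallest eigenvalue of the graph Laplacian) of $G$, with the convention $a(G)=\infty$ if $G$ has a single vertex. $G[A]$ is the induced subgraph on $A$; for disjoint $A,B\subseteq V$, $G(A,B)$ is the graph with vertex set $A\cup B$ and edge set $\{e\in E: |e\cap A|=|e\cap B|=1\}$. $G$ is $d$-rigid if $\operatorname{rank}R(G,p)=d|V|-\binom{d+1}{2}$ for some $p$ (equivalently $a_d(G)>0$). *)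

theory Defs
  imports
    "Jordan_Normal_Form.Char_Poly"
    "Jordan_Normal_Form.DL_Rank"
    "HOL-Library.Extended_Real"
    "HOL-Library.Disjoint_Sets"
begin

type_synonym 'a graph = "'a set \<times> 'a set set"

definition finite_simple_graph :: "'a graph \<Rightarrow> bool" where
  "finite_simple_graph G \<longleftrightarrow> finite (fst G) \<and> snd G \<subseteq> {e. e \<subseteq> fst G \<and> card e = 2}"

definition induced :: "'a graph \<Rightarrow> 'a set \<Rightarrow> 'a graph" where
  "induced G A = (A, {e \<in> snd G. e \<subseteq> A})"

definition between :: "'a graph \<Rightarrow> 'a set \<Rightarrow> 'a set \<Rightarrow> 'a graph" where
  "between G A B = (A \<union> B, {e \<in> snd G. card (e \<inter> A) = 1 \<and> card (e \<inter> B) = 1})"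

definition graph_connected :: "'a graph \<Rightarrow> bool" where
  "graph_connected G \<longleftrightarrow> fst G \<noteq> {} \<and>
     (\<forall>u \<in> fst G. \<forall>v \<in> fst G. (u, v) \<in> {(x, y). {x, y} \<in> snd G}\<^sup>*)"

text \<open>
  Matrices indexed by vertices and edges are made into matrices with numeric indices by fixing an
  arbitrary enumeration of a finite set. Ranks and spectra do not depend on this choice.
\<close>

definition enumeration :: "'b set \<Rightarrow> 'b list" where
  "enumeration S = (SOME xs. distinct xs \<and> set xs = S)"

text \<open>
  The k-th smallest eigenvalue, k = 1, 2, ..., counted with algebraic multiplicity. It is meant for
  real symmetric matrices, whose characteristic polynomial has only real roots, and for k between 1
  and the dimension.
\<close>

definition kth_eigenvalue :: "nat \<Rightarrow> real mat \<Rightarrow> real" where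
  "kth_eigenvalue k M = sorted_list_of_multiset (proots (char_poly M)) ! (k - 1)"

definition laplacian :: "'a graph \<Rightarrow> real mat" where
  "laplacian G = (let vs = enumeration (fst G) in
     mat (card (fst G)) (card (fst G)) (\<lambda>(i, j).
       if i = j then real (card {e \<in> snd G. vs ! i \<in> e})
       else if {vs ! i, vs ! j} \<in> snd G then - 1 else 0))"

definition algebraic_connectivity :: "'a graph \<Rightarrow> ereal" where
  "algebraic_connectivity G =
     (if card (fst G) = 1 then \<infinity> else ereal (kth_eigenvalue 2 (laplacian G)))"

definition direction :: "nat \<Rightarrow> ('a \<Rightarrow> real vec) \<Rightarrow> 'a \<Rightarrow> 'a \<Rightarrow> real vec" where
  "direction d p u v =
     (if p u \<noteq> p v
      then (1 / sqrt ((p u - p v) \<bullet> (p u - p v))) \<cdot>\<^sub>v (p u - p v)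
      else 0\<^sub>v d)"

text \<open>
  An arbitrary orientation of an edge. The column (1_u - 1_v) \<otimes> d_uv of the rigidity matrix is
  unchanged when u and v are swapped.
\<close>

definition edge_ends :: "'a set \<Rightarrow> 'a \<times> 'a" where
  "edge_ends e = (SOME (u, v). e = {u, v})"

text \<open>Row r of the rigidity matrix belongs to vertex number r div d and coordinate r mod d.\<close>

definition rigidity_matrix :: "nat \<Rightarrow> 'a graph \<Rightarrow> ('a \<Rightarrow> real vec) \<Rightarrow> real mat" where
  "rigidity_matrix d G p = (let vs = enumeration (fst G); es = enumeration (snd G) in
     mat (d * card (fst G)) (card (snd G)) (\<lambda>(r, c).
       let w = vs ! (r div d); (u, v) = edge_ends (es ! c)
       in (of_bool (w = u) - of_bool (w = v)) * (direction d p u v $ (r mod d))))"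

definition stiffness_matrix :: "nat \<Rightarrow> 'a graph \<Rightarrow> ('a \<Rightarrow> real vec) \<Rightarrow> real mat" where
  "stiffness_matrix d G p = rigidity_matrix d G p * transpose_mat (rigidity_matrix d G p)"

definition algebraic_connectivity_dim :: "nat \<Rightarrow> 'a graph \<Rightarrow> ereal" where
  "algebraic_connectivity_dim d G =
     (SUP p \<in> {p. \<forall>v \<in> fst G. p v \<in> carrier_vec d}.
        ereal (kth_eigenvalue (((d + 1) choose 2) + 1) (stiffness_matrix d G p)))"

text \<open>The rank condition is stated over the integers to avoid truncated subtraction.\<close>

definition rigid :: "nat \<Rightarrow> 'a graph \<Rightarrow> bool" where
  "rigid d G \<longleftrightarrow> (\<exists>p. (\<forall>v \<in> fst G. p v \<in> carrier_vec d) \<and>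
     int (vec_space.rank (d * card (fst G)) (rigidity_matrix d G p))
       = int (d * card (fst G)) - int ((d + 1) choose 2))"

end

theory Submission
  imports Defs "Jordan_Normal_Form.Spectral_Radius"
begin

text \<open>
  Put the vertices of the i-th part at e_i + s_v (1,...,1) with distinct small s_v. Edges inside a
  part then have direction (1,...,1)/sqrt d, and edges between parts i and j have direction close
  to (e_i - e_j)/sqrt 2. In the limit the stiffness form of a displacement x is the sum of
  the Laplacian forms of the graphs on the parts, evaluated at (sum of coordinates of x)/sqrt d, and
  of the graphs between two parts, evaluated at (x_i - x_j)/sqrt 2. Asking each of these functions
  to have mean zero costs one linear condition per part and per pair of parts, (d+1 choose 2) in
  total, and then every Laplacian form is bounded below by its algebraic connectivity. At a vertex
  of part i the resulting squares dominate the squared norm of x, because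
  S^2/d + sum_j (x_i - x_j)^2 = sum_j x_j^2 + (S - d x_i)^2/d with S the sum of the x_j.
  The theorem follows from the min-max principle; for rigidity, the trivial motions of the
  framework give the matching upper bound on the rank.
\<close>

section \<open>Symmetric matrices and rank\<close>

text \<open>If all vertices of a part sat at one point, the edges inside that part would have
  direction 0 and contribute nothing. The offsets s_v remove this defect. They run along (1,...,1)
  because that vector is orthogonal to every e_i - e_j: edges inside a part see the coordinate sum,
  about which edges between parts say nothing in the limit. The direction inside a part does not
  depend on the size of the offsets, so shrinking them costs nothing there, while it brings the
  directions between parts close to their limits. What remains is an error proportional to the tilt,
  relative to the squared norm of x. The supremum absorbs it in the eigenvalue bound; for rigidity
  it only has to stay below the positive minimum. The factor 1/2 in the theorem is 1/|e_i - e_j|^2.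
  At a vertex of part i only the d families containing i are used: S^2/d enters with weight
  a(G[A_i]) and (x_i - x_j)^2 with weight a(G(A_i,A_j))/2, so the minimum of these numbers is a
  common factor.\<close>

lemma underdetermined_nontrivial_solution:
  fixes A :: "'a :: field mat"
  assumes A: "A \<in> carrier_mat m n" and "m < n"
  shows "\<exists>x\<in>carrier_vec n. x \<noteq> 0\<^sub>v n \<and> A *\<^sub>v x = 0\<^sub>v m"
proof -
  \<comment> \<open>Zero rows pad \<open>A\<close> to a square matrix; as \<open>m < n\<close>, its
    row \<open>n - 1\<close> is zero and the determinant vanishes.\<close>
  define B where "B = mat\<^sub>r n n (\<lambda>i. if i < m then row A i else 0\<^sub>v n)"
  have B: "B \<in> carrier_mat n n" by (simp add: B_def)
  have "det B = 0"
  proof -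
    have "B = mat\<^sub>r n n (\<lambda>i. if i = n - 1 then 0\<^sub>v n else (if i < m then row A i else 0\<^sub>v n))"
      unfolding B_def using \<open>m < n\<close> by (intro eq_matI) auto
    then show ?thesis
      using det_row_0[of "n - 1" n "\<lambda>i. if i < m then row A i else 0\<^sub>v n"] A \<open>m < n\<close> by auto
  qed
  then obtain x where x: "x \<in> carrier_vec n" "x \<noteq> 0\<^sub>v n" "B *\<^sub>v x = 0\<^sub>v n"
    using det_0_iff_vec_prod_zero[OF B] by blast
  have "A *\<^sub>v x = 0\<^sub>v m"
  proof (rule eq_vecI)
    fix i assume "i < dim_vec (0\<^sub>v m :: 'a vec)"
    then have i: "i < m" "i < n" using \<open>m < n\<close> by auto
    have "(B *\<^sub>v x) $ i = row A i \<bullet> x"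
      using i A by (simp add: B_def)
    then show "(A *\<^sub>v x) $ i = 0\<^sub>v m $ i" using x(3) i A by simp
  qed (use A in simp)
  with x show ?thesis by blast
qed

text \<open>The dimension count behind both the min-max principle and the lower bound on the rank:
  subspaces are described by finitely many linear conditions, so intersecting them means taking a
  union of sets.\<close>

lemma exists_orthogonal_vec:
  fixes F :: "'a :: field vec set"
  assumes "finite F" "F \<subseteq> carrier_vec n" "card F < n"
  obtains x where "x \<in> carrier_vec n" "x \<noteq> 0\<^sub>v n" "\<And>f. f \<in> F \<Longrightarrow> f \<bullet> x = 0"
proof -
  obtain fs where fs: "set fs = F" "distinct fs" using finite_distinct_list[OF assms(1)] by blast
  have "mat_of_rows n fs \<in> carrier_mat (length fs) n" by simp
  moreover have "length fs < n" using fs assms(3) distinct_card by fastforce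
  ultimately obtain x where x: "x \<in> carrier_vec n" "x \<noteq> 0\<^sub>v n"
    "mat_of_rows n fs *\<^sub>v x = 0\<^sub>v (length fs)"
    using underdetermined_nontrivial_solution by blast
  have "f \<bullet> x = 0" if f: "f \<in> F" for f
  proof -
    obtain i where i: "i < length fs" "fs ! i = f" using f fs(1) by (auto simp: in_set_conv_nth)
    have "(mat_of_rows n fs *\<^sub>v x) $ i = f \<bullet> x"
      using i assms(2) that by (auto simp: mat_of_rows_row)
    then show ?thesis using x(3) i by simp
  qed
  with x that show thesis by blast
qed

section \<open>The spectral theorem for real symmetric matrices\<close>

lemma real_scalar_prod_self: "(x :: real vec) \<bullet> x = (\<Sum>i<dim_vec x. (x $ i)\<^sup>2)"
  by (simp add: scalar_prod_def power2_eq_square atLeast0LessThan)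

lemma real_scalar_prod_self_eq_0: "(x :: real vec) \<in> carrier_vec n \<Longrightarrow> x \<bullet> x = 0 \<longleftrightarrow> x = 0\<^sub>v n"
  by (auto simp: real_scalar_prod_self sum_nonneg_eq_0_iff)

lemma real_scalar_prod_self_pos: "(x :: real vec) \<in> carrier_vec n \<Longrightarrow> x \<noteq> 0\<^sub>v n \<Longrightarrow> x \<bullet> x > 0"
  using real_scalar_prod_self_eq_0[of x n] real_scalar_prod_self[of x]
  by (simp add: order_less_le sum_nonneg)

text \<open>Over the complex numbers some eigenvector \<open>u\<close> with eigenvalue
  \<open>z\<close> exists. Its real and imaginary parts span a real invariant subspace, symmetry
  forces \<open>Im z = 0\<close>, and then whichever part is nonzero is a real eigenvector.\<close>

lemma symmetric_real_eigenvector: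
  fixes M :: "real mat"
  assumes M: "M \<in> carrier_mat n n" and sym: "transpose_mat M = M" and "n > 0"
  obtains v e where "v \<in> carrier_vec n" "v \<bullet> v = 1" "M *\<^sub>v v = e \<cdot>\<^sub>v v"
proof -
  let ?C = "map_mat complex_of_real M"
  have C: "?C \<in> carrier_mat n n" using M by simp
  obtain z where "z \<in> spectrum ?C" using spectrum_non_empty[OF C \<open>n > 0\<close>] by blast
  then obtain u where "eigenvector ?C u z" unfolding spectrum_def eigenvalue_def by blast
  then have u: "u \<in> carrier_vec n" "u \<noteq> 0\<^sub>v n" "?C *\<^sub>v u = z \<cdot>\<^sub>v u"
    using C unfolding eigenvector_def by auto
  define a b where "a = map_vec Re u" and "b = map_vec Im u"
  have ab: "a \<in> carrier_vec n" "b \<in> carrier_vec n" using u by (auto simp: a_def b_def)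
  have row: "(\<Sum>j<n. complex_of_real (M $$ (i,j)) * u $ j) = z * u $ i" if "i < n" for i
  proof -
    have "(?C *\<^sub>v u) $ i = (\<Sum>j<n. complex_of_real (M $$ (i,j)) * u $ j)"
      using that C u(1) M by (auto simp: scalar_prod_def atLeast0LessThan intro!: sum.cong)
    then show ?thesis using u that by simp
  qed
  have Ma: "M *\<^sub>v a = Re z \<cdot>\<^sub>v a - Im z \<cdot>\<^sub>v b"
  proof (rule eq_vecI)
    fix i assume "i < dim_vec (Re z \<cdot>\<^sub>v a - Im z \<cdot>\<^sub>v b)"
    then have i: "i < n" using ab by simp
    have "(M *\<^sub>v a) $ i = Re (\<Sum>j<n. complex_of_real (M $$ (i,j)) * u $ j)"
      using i M u(1) by (auto simp: a_def scalar_prod_def atLeast0LessThan intro!: sum.cong)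
    then show "(M *\<^sub>v a) $ i = (Re z \<cdot>\<^sub>v a - Im z \<cdot>\<^sub>v b) $ i"
      using row[OF i] i u by (simp add: a_def b_def)
  qed (use ab M in auto)
  have Mb: "M *\<^sub>v b = Im z \<cdot>\<^sub>v a + Re z \<cdot>\<^sub>v b"
  proof (rule eq_vecI)
    fix i assume "i < dim_vec (Im z \<cdot>\<^sub>v a + Re z \<cdot>\<^sub>v b)"
    then have i: "i < n" using ab by simp
    have "(M *\<^sub>v b) $ i = Im (\<Sum>j<n. complex_of_real (M $$ (i,j)) * u $ j)"
      using i M u(1) by (auto simp: b_def scalar_prod_def atLeast0LessThan intro!: sum.cong)
    then show "(M *\<^sub>v b) $ i = (Im z \<cdot>\<^sub>v a + Re z \<cdot>\<^sub>v b) $ i"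
      using row[OF i] i u by (simp add: a_def b_def)
  qed (use ab M in auto)
  have nz: "a \<noteq> 0\<^sub>v n \<or> b \<noteq> 0\<^sub>v n"
  proof (rule ccontr)
    assume "\<not> ?thesis"
    then have "a $ i = 0" "b $ i = 0" if "i < n" for i
      using that by auto
    then have "u $ i = 0" if "i < n" for i
      using that u(1) by (auto simp: a_def b_def complex_eq_iff)
    then have "u = 0\<^sub>v n" using u by (intro eq_vecI) auto
    with u show False by simp
  qed
  \<comment> \<open>Both sides contain the term \<open>Re z * (a \<bullet> b)\<close>; after
    cancelling it, \<open>- Im z * (b \<bullet> b) = Im z * (a \<bullet> a)\<close> remains.\<close>
  have "b \<bullet> (M *\<^sub>v a) = (M *\<^sub>v b) \<bullet> a"
    using transpose_vec_mult_scalar[OF M ab] sym by simp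
  then have "Im z * (a \<bullet> a + b \<bullet> b) = 0"
    unfolding Ma Mb using ab
    by (simp add: scalar_prod_minus_distrib add_scalar_prod_distrib[of _ n] comm_scalar_prod[of b n a] algebra_simps)
  moreover have "a \<bullet> a + b \<bullet> b > 0"
  proof -
    have "a \<bullet> a \<ge> 0" "b \<bullet> b \<ge> 0" by (simp_all add: real_scalar_prod_self sum_nonneg)
    with nz ab show ?thesis
      using real_scalar_prod_self_pos[of a n] real_scalar_prod_self_pos[of b n] by linarith
  qed
  ultimately have "Im z = 0" by simp
  then have eig: "M *\<^sub>v a = Re z \<cdot>\<^sub>v a" "M *\<^sub>v b = Re z \<cdot>\<^sub>v b"
    unfolding Ma Mb using ab by (auto intro!: eq_vecI)
  obtain w where w: "w \<in> carrier_vec n" "w \<noteq> 0\<^sub>v n" "M *\<^sub>v w = Re z \<cdot>\<^sub>v w"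
    using nz eig ab by blast
  have pos: "w \<bullet> w > 0" using real_scalar_prod_self_pos w by blast
  define v where "v = (1 / sqrt (w \<bullet> w)) \<cdot>\<^sub>v w"
  show thesis
  proof
    show "v \<in> carrier_vec n" using w by (simp add: v_def)
    show "v \<bullet> v = 1" using w pos by (simp add: v_def)
    show "M *\<^sub>v v = Re z \<cdot>\<^sub>v v"
      using w M by (simp add: v_def mult_mat_vec smult_smult_assoc mult.commute)
  qed
qed

text \<open>The witness is the Householder reflection that exchanges the first unit vector and v.\<close>

lemma orthogonal_mat_first_col:
  fixes v :: "real vec"
  assumes v: "v \<in> carrier_vec n" "v \<bullet> v = 1" and "n > 0"
  obtains H where "H \<in> carrier_mat n n" "transpose_mat H = H" "H * H = 1\<^sub>m n"
    "H *\<^sub>v unit_vec n 0 = v"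
proof (cases "v = unit_vec n 0")
  case True
  show thesis by (rule that[of "1\<^sub>m n"]) (use True in auto)
next
  case False
  define w where "w = v - unit_vec n 0"
  define c where "c = 2 / (w \<bullet> w)"
  have w: "w \<in> carrier_vec n" using v by (simp add: w_def)
  have "w \<noteq> 0\<^sub>v n"
  proof
    assume "w = 0\<^sub>v n"
    then have "v = unit_vec n 0" using v by (intro eq_vecI)
        (auto simp: w_def dest!: arg_cong[where f = "\<lambda>x. x $ i" for i] vec_eq_iff[THEN iffD1])
    with False show False by simp
  qed
  then have pos: "w \<bullet> w > 0" using real_scalar_prod_self_pos w by blast
  \<comment> \<open>Since \<open>v\<close> and the unit vector both have norm 1, the squared norm of
    their difference is 2 - 2 v_0. This is what makes the reflection along \<open>w\<close> exchange
    the two vectors.\<close>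
  have ww: "w \<bullet> w = - 2 * w $ 0"
  proof -
    have "w \<bullet> w = v \<bullet> v - 2 * (v \<bullet> unit_vec n 0) + unit_vec n 0 \<bullet> (unit_vec n 0 :: real vec)"
      unfolding w_def using v
      by (simp add: scalar_prod_minus_distrib[of _ n] minus_scalar_prod_distrib[of _ n]
          comm_scalar_prod[of "unit_vec n 0" n v])
    then show ?thesis using v \<open>n > 0\<close> by (simp add: w_def)
  qed
  have sum_ww: "(\<Sum>k<n. w $ k * w $ k) = w \<bullet> w"
    using w by (simp add: scalar_prod_def atLeast0LessThan)
  define H where "H = mat n n (\<lambda>(i,j). of_bool (i = j) - c * w $ i * w $ j)"
  have entry: "(H * H) $$ (i,j) = of_bool (i = j)" if "i < n" "j < n" for i j
  proof -
    have "(H * H) $$ (i,j) = (\<Sum>k<n. (of_bool (i = k) - c * w $ i * w $ k) * (of_bool (k = j) - c * w $ k * w $ j))"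
      using that by (simp add: H_def scalar_prod_def atLeast0LessThan)
    also have "\<dots> = (\<Sum>k<n. of_bool (i = k) * of_bool (k = j)) - (\<Sum>k<n. of_bool (i = k) * (c * w $ k * w $ j))
        - (\<Sum>k<n. of_bool (k = j) * (c * w $ i * w $ k)) + c * c * w $ i * w $ j * (\<Sum>k<n. w $ k * w $ k)"
      by (simp add: algebra_simps sum.distrib sum_subtractf sum_distrib_left)
    also have "\<dots> = of_bool (i = j) - 2 * c * w $ i * w $ j + c * (c * (w \<bullet> w)) * w $ i * w $ j"
      using that by (simp add: sum_ww of_bool_def if_distrib[where f = "\<lambda>x. x * y" for y] cong: if_cong)
    also have "c * (w \<bullet> w) = 2" using pos by (simp add: c_def)
    finally show ?thesis by simp
  qed
  show thesis
  proof
    show "H \<in> carrier_mat n n" by (simp add: H_def)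
    show "transpose_mat H = H" by (intro eq_matI) (auto simp: H_def)
    show "H * H = 1\<^sub>m n" by (rule eq_matI) (use entry in \<open>auto simp: H_def\<close>)
    show "H *\<^sub>v unit_vec n 0 = v"
    proof (rule eq_vecI)
      fix i assume "i < dim_vec v"
      then have i: "i < n" using v by simp
      have "(H *\<^sub>v unit_vec n 0) $ i = H $$ (i, 0)"
        using i \<open>n > 0\<close> by (simp add: H_def)
      also have "\<dots> = of_bool (i = 0) - c * w $ 0 * w $ i"
        using i \<open>n > 0\<close> by (simp add: H_def)
      also have "c * w $ 0 = - 1" using pos ww by (simp add: c_def)
      finally show "(H *\<^sub>v unit_vec n 0) $ i = v $ i"
        using i v by (simp add: w_def)
    qed (use v in \<open>simp add: H_def\<close>)
  qed
qed

text \<open>Deflation: conjugating with a reflection that sends the first unit vector to an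
  eigenvector clears the first row and column outside the corner, and the induction hypothesis
  diagonalizes the remaining block. The reflection is its own transpose and inverse, so the
  conjugate stays symmetric.\<close>

lemma real_spectral_theorem:
  fixes M :: "real mat"
  assumes "M \<in> carrier_mat n n" "transpose_mat M = M"
  shows "\<exists>P D. P \<in> carrier_mat n n \<and> D \<in> carrier_mat n n \<and> transpose_mat P * P = 1\<^sub>m n \<and>
    diagonal_mat D \<and> M = P * D * transpose_mat P"
  using assms
proof (induction n arbitrary: M)
  case 0
  show ?case
    by (rule exI[of _ "0\<^sub>m 0 0"], rule exI[of _ "0\<^sub>m 0 0"])
      (use 0 in \<open>auto simp: diagonal_mat_def intro!: eq_matI\<close>)
next
  case (Suc n)
  note M = Suc.prems(1) and sym = Suc.prems(2)
  let ?N = "Suc n"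
  obtain v e where v: "v \<in> carrier_vec ?N" "v \<bullet> v = 1" "M *\<^sub>v v = e \<cdot>\<^sub>v v"
    using symmetric_real_eigenvector[OF M sym] by blast
  obtain H where H: "H \<in> carrier_mat ?N ?N" "transpose_mat H = H" "H * H = 1\<^sub>m ?N"
    "H *\<^sub>v unit_vec ?N 0 = v"
    using orthogonal_mat_first_col[OF v(1,2)] by blast
  define K where "K = H * M * H"
  have K: "K \<in> carrier_mat ?N ?N" using H M by (simp add: K_def)
  have Ksym: "transpose_mat K = K"
    using H M sym by (simp add: K_def transpose_mult[of _ ?N ?N _ ?N] assoc_mult_mat[of _ ?N ?N _ ?N _ ?N])
  have HKH: "M = H * K * H"
  proof -
    have "H * K * H = (H * H) * M * (H * H)"
      unfolding K_def using H(1) M by (simp add: assoc_mult_mat[of _ ?N ?N _ ?N _ ?N])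
    then show ?thesis using H M by simp
  qed
  have Hv: "H *\<^sub>v v = unit_vec ?N 0"
    using H assoc_mult_mat_vec[OF H(1) H(1), of "unit_vec ?N 0"] by simp
  have "K *\<^sub>v unit_vec ?N 0 = e \<cdot>\<^sub>v unit_vec ?N 0"
    unfolding K_def using H M v Hv by (simp add: assoc_mult_mat_vec[of _ ?N ?N _ ?N] mult_mat_vec[of _ ?N ?N])
  then have col0: "K $$ (i, 0) = (if i = 0 then e else 0)" if "i < ?N" for i
    using that K by (auto dest!: arg_cong[where f = "\<lambda>x. x $ i"])
  have row0: "K $$ (0, i) = (if i = 0 then e else 0)" if "i < ?N" for i
    using col0[OF that] Ksym K that by (metis carrier_matD index_transpose_mat(1) zero_less_Suc)
  define M' where "M' = mat n n (\<lambda>(i,j). K $$ (Suc i, Suc j))"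
  have M': "M' \<in> carrier_mat n n" by (simp add: M'_def)
  have Kentry: "K $$ (i,j) = K $$ (j,i)" if "i < ?N" "j < ?N" for i j
    using Ksym K that by (metis carrier_matD index_transpose_mat(1))
  have M'sym: "transpose_mat M' = M'"
    by (rule eq_matI) (auto simp: M'_def Kentry)
  obtain P D where PD: "P \<in> carrier_mat n n" "D \<in> carrier_mat n n" "transpose_mat P * P = 1\<^sub>m n"
    "diagonal_mat D" "M' = P * D * transpose_mat P"
    using Suc.IH[OF M' M'sym] by blast
  define B where "B = four_block_mat (1\<^sub>m 1) (0\<^sub>m 1 n) (0\<^sub>m n 1) P"
  define D' where "D' = four_block_mat (mat 1 1 (\<lambda>_. e)) (0\<^sub>m 1 n) (0\<^sub>m n 1) D"
  have B: "B \<in> carrier_mat ?N ?N" using PD(1) by (auto simp: B_def)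
  have D': "D' \<in> carrier_mat ?N ?N" using PD(2) by (auto simp: D'_def)
  have BT: "transpose_mat B = four_block_mat (1\<^sub>m 1) (0\<^sub>m 1 n) (0\<^sub>m n 1) (transpose_mat P)"
    unfolding B_def using PD(1) by (subst transpose_four_block_mat) auto
  have BTB: "transpose_mat B * B = 1\<^sub>m ?N"
    unfolding BT unfolding B_def using PD(1,3)
    by (subst mult_four_block_mat[of _ 1 1 _ n _ n _ _ 1 _ n]) (auto intro!: eq_matI)
  have "B * D' * transpose_mat B = four_block_mat (mat 1 1 (\<lambda>_. e)) (0\<^sub>m 1 n) (0\<^sub>m n 1) M'"
    unfolding BT unfolding B_def D'_def PD(5) using PD(1,2)
    by (simp add: mult_four_block_mat[of _ 1 1 _ n _ n _ _ 1 _ n])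
  also have "\<dots> = K"
    by (rule eq_matI) (use K col0 row0 in \<open>auto simp: M'_def\<close>)
  finally have K_eq: "K = B * D' * transpose_mat B" by simp
  show ?case
  proof (intro exI conjI)
    show "H * B \<in> carrier_mat ?N ?N" using H B by simp
    show "D' \<in> carrier_mat ?N ?N" by (rule D')
    have T: "transpose_mat (H * B) = transpose_mat B * H"
      using H B by (simp add: transpose_mult[of _ ?N ?N _ ?N])
    have "transpose_mat B * H * (H * B) = transpose_mat B * (H * H) * B"
      using H(1) B by (simp add: assoc_mult_mat[of _ ?N ?N _ ?N _ ?N])
    then show "transpose_mat (H * B) * (H * B) = 1\<^sub>m ?N"
      unfolding T using H B BTB by simp
    show "diagonal_mat D'"
      using PD(2,4) by (auto simp: diagonal_mat_def D'_def)
    show "M = H * B * D' * transpose_mat (H * B)"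
      unfolding T unfolding HKH K_eq using H(1) B D' by (simp add: assoc_mult_mat[of _ ?N ?N _ ?N _ ?N])
  qed
qed

section \<open>Ordered eigenvalues and the min-max principle\<close>

text \<open>Turns a position in the sorted list into the two counts that the halves of the min-max
  principle need. Repeated values are the reason for inequalities: ties with entry \<open>k\<close>
  may stand on either side of it. The index \<open>k\<close> starts at 0 here, whereas
  \<open>kth_eigenvalue\<close> counts from 1.\<close>

lemma sorted_nth_le_imp_card:
  fixes \<mu> :: "nat \<Rightarrow> 'a :: linorder"
  assumes "k < n"
  shows "card {i. i < n \<and> \<mu> i \<le> sort (map \<mu> [0..<n]) ! k} > k"
    and "card {i. i < n \<and> \<mu> i < sort (map \<mu> [0..<n]) ! k} \<le> k"
proof -
  let ?l = "map \<mu> [0..<n]"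
  let ?s = "sort ?l"
  have card_filter: "card {i. i < n \<and> Q (\<mu> i)} = card {i. i < n \<and> Q (?s ! i)}" for Q
  proof -
    have "card {i. i < n \<and> Q (\<mu> i)} = length (filter Q ?l)"
      by (subst length_filter_conv_card) (auto intro!: arg_cong[where f = card])
    also have "\<dots> = length (filter Q ?s)"
      by (metis mset_filter mset_sort size_mset)
    also have "\<dots> = card {i. i < n \<and> Q (?s ! i)}"
      by (subst length_filter_conv_card) simp
    finally show ?thesis .
  qed
  have mono: "i \<le> j \<Longrightarrow> j < n \<Longrightarrow> ?s ! i \<le> ?s ! j" for i j
    by (rule sorted_nth_mono) auto
  have "{..k} \<subseteq> {i. i < n \<and> ?s ! i \<le> ?s ! k}" using mono assms by auto
  then have "card {..k} \<le> card {i. i < n \<and> ?s ! i \<le> ?s ! k}" by (intro card_mono) auto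
  then show "card {i. i < n \<and> \<mu> i \<le> ?s ! k} > k"
    unfolding card_filter[of "\<lambda>x. x \<le> ?s ! k"] by simp
  have "{i. i < n \<and> ?s ! i < ?s ! k} \<subseteq> {..<k}" using mono by (force simp: not_less[symmetric])
  then have "card {i. i < n \<and> ?s ! i < ?s ! k} \<le> card {..<k}" by (intro card_mono) auto
  then show "card {i. i < n \<and> \<mu> i < ?s ! k} \<le> k"
    unfolding card_filter[of "\<lambda>x. x < ?s ! k"] by simp
qed

lemma proots_prod_list_linear:
  fixes es :: "'a :: idom list"
  shows "proots (\<Prod>e\<leftarrow>es. [:- e, 1:]) = mset es"
proof (induction es)
  case (Cons e es)
  have "(\<Prod>e\<leftarrow>es. [:- e, 1:]) \<noteq> 0" by (auto simp: prod_list_zero_iff)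
  then have "proots ([:- e, 1:] * (\<Prod>e\<leftarrow>es. [:- e, 1:])) = {#e#} + proots (\<Prod>e\<leftarrow>es. [:- e, 1:])"
    by (subst proots_mult) auto
  then show ?case using Cons by simp
qed simp

text \<open>The spectral theorem in coordinates: the norm and the form become sums over the
  eigenvectors \<open>w i\<close>, and the eigenvalues defined through the characteristic polynomial
  are the sorted coefficients. Later arguments use only this.\<close>

lemma symmetric_diagonalization:
  fixes M :: "real mat"
  assumes M: "M \<in> carrier_mat n n" "transpose_mat M = M"
  obtains w \<mu> where "\<And>i. i < n \<Longrightarrow> w i \<in> carrier_vec n"
    "\<And>x. x \<in> carrier_vec n \<Longrightarrow> x \<bullet> x = (\<Sum>i<n. (w i \<bullet> x)\<^sup>2)"
    "\<And>x. x \<in> carrier_vec n \<Longrightarrow> x \<bullet> (M *\<^sub>v x) = (\<Sum>i<n. \<mu> i * (w i \<bullet> x)\<^sup>2)"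
    "\<And>k. kth_eigenvalue k M = sort (map \<mu> [0..<n]) ! (k - 1)"
proof -
  obtain P D where PD: "P \<in> carrier_mat n n" "D \<in> carrier_mat n n" "transpose_mat P * P = 1\<^sub>m n"
    "diagonal_mat D" "M = P * D * transpose_mat P"
    using real_spectral_theorem[OF M] by blast
  have PT: "transpose_mat P \<in> carrier_mat n n" using PD(1) by simp
  have PPT: "P * transpose_mat P = 1\<^sub>m n"
    using mat_mult_left_right_inverse[OF PT PD(1) PD(3)] .
  have y: "(transpose_mat P *\<^sub>v x) $ i = col P i \<bullet> x" if "i < n" for x i
    using that PD(1) by simp
  have Dy: "(D *\<^sub>v y) $ i = D $$ (i,i) * y $ i" if i: "i < n" and yc: "y \<in> carrier_vec n" for y i
  proof -
    have "(D *\<^sub>v y) $ i = (\<Sum>j<n. D $$ (i,j) * y $ j)"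
      using i yc PD(2) by (auto simp: scalar_prod_def atLeast0LessThan intro!: sum.cong)
    also have "\<dots> = (\<Sum>j<n. if j = i then D $$ (i,i) * y $ i else 0)"
      using PD(2,4) i by (intro sum.cong) (auto simp: diagonal_mat_def)
    finally show ?thesis using i by simp
  qed
  show thesis
  proof (rule that[of "col P" "\<lambda>i. D $$ (i,i)"])
    show "col P i \<in> carrier_vec n" if "i < n" for i using that PD(1) by simp
    fix x :: "real vec" assume x: "x \<in> carrier_vec n"
    let ?y = "transpose_mat P *\<^sub>v x"
    have yc: "?y \<in> carrier_vec n" using PD(1) x by simp
    have Py: "P *\<^sub>v ?y = x"
      using assoc_mult_mat_vec[OF PD(1) PT x] PPT x by simp
    have "?y \<bullet> ?y = x \<bullet> x"
      using transpose_vec_mult_scalar[OF PD(1) yc x] Py by simp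
    moreover have "?y \<bullet> ?y = (\<Sum>i<n. (col P i \<bullet> x)\<^sup>2)"
      unfolding real_scalar_prod_self using PD(1) y by simp
    ultimately show "x \<bullet> x = (\<Sum>i<n. (col P i \<bullet> x)\<^sup>2)" by simp
    have "M *\<^sub>v x = P *\<^sub>v (D *\<^sub>v ?y)"
      unfolding PD(5) using PD(1,2) x by (simp add: assoc_mult_mat_vec[of _ n n _ n])
    then have "x \<bullet> (M *\<^sub>v x) = ?y \<bullet> (D *\<^sub>v ?y)"
      using transpose_vec_mult_scalar[OF PD(1) _ x, of "D *\<^sub>v ?y"] PD(2) yc by simp
    also have "\<dots> = (\<Sum>i<n. ?y $ i * (D *\<^sub>v ?y) $ i)"
      using PD(2) by (simp add: scalar_prod_def atLeast0LessThan)
    also have "\<dots> = (\<Sum>i<n. D $$ (i,i) * (col P i \<bullet> x)\<^sup>2)"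
      using Dy[OF _ yc] y by (intro sum.cong) (auto simp: power2_eq_square simp del: index_mult_mat_vec)
    finally show "x \<bullet> (M *\<^sub>v x) = (\<Sum>i<n. D $$ (i,i) * (col P i \<bullet> x)\<^sup>2)" .
  next
    fix k
    have "similar_mat_wit M D P (transpose_mat P)"
      using M PD PPT by (auto simp: similar_mat_wit_def Let_def)
    then have "char_poly M = char_poly D"
      by (intro char_poly_similar) (auto simp: similar_mat_def)
    also have "\<dots> = (\<Prod>a\<leftarrow>diag_mat D. [:- a, 1:])"
      using PD(2,4) by (intro char_poly_upper_triangular) (auto simp: diagonal_mat_def)
    finally have "proots (char_poly M) = mset (diag_mat D)"
      by (simp add: proots_prod_list_linear)
    then show "kth_eigenvalue k M = sort (map (\<lambda>i. D $$ (i,i)) [0..<n]) ! (k - 1)"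
      using PD(2) sorted_list_of_multiset_mset[of "diag_mat D"]
      by (simp add: kth_eigenvalue_def diag_mat_def del: mset_map sorted_list_of_multiset_mset)
  qed
qed

text \<open>The eigenvectors with eigenvalue above the k-th number at most \<open>n - k\<close>.
  Together with fewer than \<open>k\<close> conditions they leave a nonzero common orthogonal
  vector, and on it the form uses only eigenvalues up to the k-th. This is the half that bounds
  \<open>kth_eigenvalue\<close> from below, by a bound for the form on a subspace of codimension
  less than \<open>k\<close>.\<close>

lemma kth_eigenvalue_max_min:
  fixes M :: "real mat"
  assumes M: "M \<in> carrier_mat n n" "transpose_mat M = M" and k: "1 \<le> k" "k \<le> n"
    and F: "finite F" "F \<subseteq> carrier_vec n" "card F < k"
  obtains x where "x \<in> carrier_vec n" "x \<noteq> 0\<^sub>v n" "\<And>f. f \<in> F \<Longrightarrow> f \<bullet> x = 0"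
    "x \<bullet> (M *\<^sub>v x) \<le> kth_eigenvalue k M * (x \<bullet> x)"
proof -
  obtain w \<mu> where w: "\<And>i. i < n \<Longrightarrow> w i \<in> carrier_vec n"
    "\<And>x. x \<in> carrier_vec n \<Longrightarrow> x \<bullet> x = (\<Sum>i<n. (w i \<bullet> x)\<^sup>2)"
    "\<And>x. x \<in> carrier_vec n \<Longrightarrow> x \<bullet> (M *\<^sub>v x) = (\<Sum>i<n. \<mu> i * (w i \<bullet> x)\<^sup>2)"
    "\<And>k. kth_eigenvalue k M = sort (map \<mu> [0..<n]) ! (k - 1)"
    using symmetric_diagonalization[OF M] by blast
  let ?l = "kth_eigenvalue k M"
  define I where "I = {i. i < n \<and> \<mu> i \<le> ?l}"
  have cI: "card I \<ge> k" using sorted_nth_le_imp_card(1)[of "k - 1" n \<mu>] k w(4)[of k] by (simp add: I_def Suc_le_eq[symmetric])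
  have "card ({..<n} - I) = n - card I" by (subst card_Diff_subset) (auto simp: I_def)
  moreover have "card (F \<union> w ` ({..<n} - I)) \<le> card F + card ({..<n} - I)"
    by (meson card_Un_le card_image_le finite_Diff finite_lessThan add_left_mono le_trans)
  ultimately have "card (F \<union> w ` ({..<n} - I)) < n" using cI F(3) k by linarith
  moreover have "finite (F \<union> w ` ({..<n} - I))" "F \<union> w ` ({..<n} - I) \<subseteq> carrier_vec n"
    using F w(1) by auto
  ultimately obtain x where x: "x \<in> carrier_vec n" "x \<noteq> 0\<^sub>v n"
    "\<And>f. f \<in> F \<union> w ` ({..<n} - I) \<Longrightarrow> f \<bullet> x = 0"
    using exists_orthogonal_vec[of "F \<union> w ` ({..<n} - I)" n] by metis
  have "x \<bullet> (M *\<^sub>v x) \<le> (\<Sum>i<n. ?l * (w i \<bullet> x)\<^sup>2)"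
    unfolding w(3)[OF x(1)]
  proof (rule sum_mono)
    fix i assume "i \<in> {..<n}"
    then show "\<mu> i * (w i \<bullet> x)\<^sup>2 \<le> ?l * (w i \<bullet> x)\<^sup>2"
      using x(3)[of "w i"] by (cases "i \<in> I") (auto simp: I_def intro!: mult_right_mono)
  qed
  also have "\<dots> = ?l * (x \<bullet> x)" by (simp add: w(2)[OF x(1)] sum_distrib_left)
  finally show thesis using that[of x] x by blast
qed

text \<open>The conditions are the eigenvectors with eigenvalue strictly below the k-th. Strictness
  keeps their number below \<open>k\<close> even when the k-th eigenvalue is multiple.\<close>

lemma kth_eigenvalue_le_on_orthogonal:
  fixes M :: "real mat"
  assumes M: "M \<in> carrier_mat n n" "transpose_mat M = M" and k: "1 \<le> k" "k \<le> n"
  obtains F where "finite F" "F \<subseteq> carrier_vec n" "card F < k"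
    "\<And>x. x \<in> carrier_vec n \<Longrightarrow> (\<And>f. f \<in> F \<Longrightarrow> f \<bullet> x = 0) \<Longrightarrow>
      kth_eigenvalue k M * (x \<bullet> x) \<le> x \<bullet> (M *\<^sub>v x)"
proof -
  obtain w \<mu> where w: "\<And>i. i < n \<Longrightarrow> w i \<in> carrier_vec n"
    "\<And>x. x \<in> carrier_vec n \<Longrightarrow> x \<bullet> x = (\<Sum>i<n. (w i \<bullet> x)\<^sup>2)"
    "\<And>x. x \<in> carrier_vec n \<Longrightarrow> x \<bullet> (M *\<^sub>v x) = (\<Sum>i<n. \<mu> i * (w i \<bullet> x)\<^sup>2)"
    "\<And>k. kth_eigenvalue k M = sort (map \<mu> [0..<n]) ! (k - 1)"
    using symmetric_diagonalization[OF M] by blast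
  let ?l = "kth_eigenvalue k M"
  define I where "I = {i. i < n \<and> \<mu> i < ?l}"
  have cI: "card I \<le> k - 1" using sorted_nth_le_imp_card(2)[of "k - 1" n \<mu>] k by (simp add: I_def w(4))
  show thesis
  proof
    show "finite (w ` I)" "w ` I \<subseteq> carrier_vec n" using w(1) by (auto simp: I_def)
    have "card (w ` I) \<le> card I" by (rule card_image_le) (simp add: I_def)
    then show "card (w ` I) < k" using cI k by linarith
    fix x assume x: "x \<in> carrier_vec n" "\<And>f. f \<in> w ` I \<Longrightarrow> f \<bullet> x = 0"
    have "?l * (x \<bullet> x) = (\<Sum>i<n. ?l * (w i \<bullet> x)\<^sup>2)" by (simp add: w(2)[OF x(1)] sum_distrib_left)
    also have "\<dots> \<le> x \<bullet> (M *\<^sub>v x)"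
      unfolding w(3)[OF x(1)]
    proof (rule sum_mono)
      fix i assume "i \<in> {..<n}"
      then show "?l * (w i \<bullet> x)\<^sup>2 \<le> \<mu> i * (w i \<bullet> x)\<^sup>2"
        using x(2)[of "w i"] by (cases "i \<in> I") (auto simp: I_def intro!: mult_right_mono)
    qed
    finally show "?l * (x \<bullet> x) \<le> x \<bullet> (M *\<^sub>v x)" .
  qed
qed

section \<open>Rank bounds from the left kernel\<close>

text \<open>If a maximal independent set of columns and \<open>F\<close> together had fewer than
  \<open>n\<close> elements, some nonzero \<open>x\<close> would be orthogonal to all of them. By
  maximality \<open>x\<close> is then orthogonal to every column, so it lies in the kernel of the
  transpose, which \<open>inj\<close> excludes.\<close>

lemma rank_ge_of_trivial_cokernel:
  fixes R :: "real mat"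
  assumes R: "R \<in> carrier_mat n m" and F: "finite F" "F \<subseteq> carrier_vec n"
    and inj: "\<And>x. x \<in> carrier_vec n \<Longrightarrow> (\<And>f. f \<in> F \<Longrightarrow> f \<bullet> x = 0) \<Longrightarrow>
      transpose_mat R *\<^sub>v x = 0\<^sub>v m \<Longrightarrow> x = 0\<^sub>v n"
  shows "n \<le> vec_space.rank n R + card F"
proof (rule ccontr)
  assume less: "\<not> ?thesis"
  interpret vec_space "TYPE(real)" n .
  have cols: "set (cols R) \<subseteq> carrier_vec n" using R cols_dim by blast
  obtain S where S: "maximal S (\<lambda>T. T \<subseteq> set (cols R) \<and> lin_indpt T)"
    using maximal_exists_superset[of "set (cols R)" "\<lambda>T. T \<subseteq> set (cols R) \<and> lin_indpt T" "{}"]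
      finite_lin_indpt2[of "{}"] by auto
  have rank: "rank R = card S" using rank_card_indpt[OF R S] .
  have Ssub: "S \<subseteq> set (cols R)" "lin_indpt S" using S by (auto simp: maximal_def)
  have finS: "finite S" using Ssub finite_subset by blast
  have "card (S \<union> F) \<le> card S + card F" by (rule card_Un_le)
  then have "card (S \<union> F) < n" using less rank by linarith
  moreover have "finite (S \<union> F)" "S \<union> F \<subseteq> carrier_vec n" using finS F Ssub cols by auto
  ultimately obtain x where x: "x \<in> carrier_vec n" "x \<noteq> 0\<^sub>v n" "\<And>f. f \<in> S \<union> F \<Longrightarrow> f \<bullet> x = 0"
    using exists_orthogonal_vec[of "S \<union> F" n] by metis
  have orth: "c \<bullet> x = 0" if c: "c \<in> set (cols R)" for c
  proof -
    have "c \<in> span S"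
    proof (cases "c \<in> S")
      case True
      then show ?thesis using Ssub cols by (meson span_mem subset_trans)
    next
      case False
      then have "lin_dep (S \<union> {c})" using S c by (auto simp: maximal_def)
      then show ?thesis
        using lin_dep_iff_in_span[of S c] Ssub cols c False by blast
    qed
    then obtain a where a: "c = lincomb a S"
      using finite_in_span[OF finS, of c] Ssub cols by blast
    have "c \<bullet> x = (\<Sum>v\<in>S. (a v \<cdot>\<^sub>v v) \<bullet> x)"
      unfolding a lincomb_def using Ssub cols x by (subst finsum_scalar_prod_sum) auto
    also have "\<dots> = 0"
      using Ssub cols x by (intro sum.neutral ballI) auto
    finally show ?thesis .
  qed
  have "transpose_mat R *\<^sub>v x = 0\<^sub>v m"
    by (rule eq_vecI) (use orth R in \<open>auto simp: cols_def\<close>)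
  then have "x = 0\<^sub>v n" using inj x by blast
  with x show False by simp
qed

text \<open>Orthogonal subspaces of a real space meet only in 0, so a maximal independent set of
  columns of \<open>R\<close> stays independent when the columns of \<open>Y\<close> are adjoined.
  If there were more than \<open>n\<close> in all, a nontrivial relation
  \<open>B a + Y b = 0\<close> would exist; pairing it with \<open>B a\<close> gives
  \<open>B a = 0\<close>, hence \<open>Y b = 0\<close>, and both coefficient vectors vanish.\<close>

lemma rank_le_of_orthogonal_independent:
  fixes R Y :: "real mat"
  assumes R: "R \<in> carrier_mat n m" and Y: "Y \<in> carrier_mat n q"
    and orth: "transpose_mat R * Y = 0\<^sub>m m q"
    and inj: "\<And>c. c \<in> carrier_vec q \<Longrightarrow> Y *\<^sub>v c = 0\<^sub>v n \<Longrightarrow> c = 0\<^sub>v q"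
  shows "vec_space.rank n R + q \<le> n"
proof (rule ccontr)
  assume less: "\<not> ?thesis"
  interpret vec_space "TYPE(real)" n .
  have cols: "set (cols R) \<subseteq> carrier_vec n" using R cols_dim by blast
  obtain S where S: "maximal S (\<lambda>T. T \<subseteq> set (cols R) \<and> lin_indpt T)"
    using maximal_exists_superset[of "set (cols R)" "\<lambda>T. T \<subseteq> set (cols R) \<and> lin_indpt T" "{}"]
      finite_lin_indpt2[of "{}"] by auto
  have rank: "rank R = card S" using rank_card_indpt[OF R S] .
  have Ssub: "S \<subseteq> set (cols R)" "lin_indpt S" using S by (auto simp: maximal_def)
  obtain ss where ss: "set ss = S" "distinct ss"
    using finite_distinct_list[of S] Ssub finite_subset by blast
  define r where "r = length ss"
  have r: "r = card S" using ss distinct_card r_def by metis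
  define B where "B = mat_of_cols n ss"
  have B: "B \<in> carrier_mat n r" by (simp add: B_def r_def)
  have ssn: "ss ! j \<in> carrier_vec n" if "j < r" for j
    using that Ssub(1) cols ss(1) r_def nth_mem[of j ss] by blast
  define C where "C = mat n (r + q) (\<lambda>(i,j). if j < r then B $$ (i,j) else Y $$ (i, j - r))"
  have "C \<in> carrier_mat n (r + q)" by (simp add: C_def)
  then obtain c where c: "c \<in> carrier_vec (r + q)" "c \<noteq> 0\<^sub>v (r + q)" "C *\<^sub>v c = 0\<^sub>v n"
    using underdetermined_nontrivial_solution[of C n "r + q"] less rank r by auto
  define a b where "a = vec_first c r" and "b = vec_last c q"
  have ab: "a \<in> carrier_vec r" "b \<in> carrier_vec q" by (simp_all add: a_def b_def)
  have sum_split: "(\<Sum>j<r + q. g j) = (\<Sum>j<r. g j) + (\<Sum>j<q. g (r + j))" for g :: "nat \<Rightarrow> real"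
    by (induction q) (auto simp: add.assoc)
  have split: "B *\<^sub>v a + Y *\<^sub>v b = 0\<^sub>v n"
  proof (rule eq_vecI)
    fix i assume "i < dim_vec (0\<^sub>v n :: real vec)"
    then have i: "i < n" by simp
    have "(C *\<^sub>v c) $ i = (\<Sum>j<r + q. (if j < r then B $$ (i,j) else Y $$ (i, j - r)) * c $ j)"
      using i c(1) by (auto simp: C_def scalar_prod_def atLeast0LessThan intro!: sum.cong)
    also have "\<dots> = (\<Sum>j<r. B $$ (i,j) * c $ j) + (\<Sum>j<q. Y $$ (i,j) * c $ (r + j))"
      unfolding sum_split by simp
    also have "\<dots> = (B *\<^sub>v a + Y *\<^sub>v b) $ i"
      using i B Y c(1) by (auto simp: a_def b_def vec_first_def vec_last_def scalar_prod_def atLeast0LessThan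
          intro!: arg_cong2[where f = "(+)"] sum.cong)
    finally show "(B *\<^sub>v a + Y *\<^sub>v b) $ i = 0\<^sub>v n $ i" using c(3) by simp
  qed (use B Y in simp)
  have BY: "(B *\<^sub>v a) \<bullet> (Y *\<^sub>v b) = 0"
  proof -
    have "col B j \<bullet> col Y l = 0" if "j < r" "l < q" for j l
    proof -
      have "col B j \<in> set (cols R)" using that ss Ssub ssn[OF that(1)]
        by (auto simp: B_def r_def)
      then obtain t where t: "t < m" "col B j = col R t" using R by (auto simp: cols_def)
      have "(transpose_mat R * Y) $$ (t, l) = col R t \<bullet> col Y l"
        using t that R Y by simp
      then show ?thesis using t that orth by simp
    qed
    then have "transpose_mat B * Y = 0\<^sub>m r q"
      using B Y by (intro eq_matI) auto
    moreover have "0\<^sub>m r q *\<^sub>v b = 0\<^sub>v r" using ab by (intro eq_vecI) auto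
    ultimately have "transpose_mat B *\<^sub>v (Y *\<^sub>v b) = 0\<^sub>v r"
      using assoc_mult_mat_vec[of "transpose_mat B" r n Y q b] B Y ab by simp
    moreover have "(B *\<^sub>v a) \<bullet> (Y *\<^sub>v b) = a \<bullet> (transpose_mat B *\<^sub>v (Y *\<^sub>v b))"
      using transpose_vec_mult_scalar[of "transpose_mat B" r n "Y *\<^sub>v b" a] B Y ab by simp
    ultimately show ?thesis using ab by simp
  qed
  have Bc: "B *\<^sub>v a \<in> carrier_vec n" "Y *\<^sub>v b \<in> carrier_vec n" using B Y ab by auto
  have "(B *\<^sub>v a) \<bullet> (B *\<^sub>v a + Y *\<^sub>v b) = (B *\<^sub>v a) \<bullet> (B *\<^sub>v a)"
    using Bc BY by (simp add: scalar_prod_add_distrib[of _ n])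
  then have "(B *\<^sub>v a) \<bullet> (B *\<^sub>v a) = 0" using split Bc by simp
  then have Ba: "B *\<^sub>v a = 0\<^sub>v n" using real_scalar_prod_self_eq_0 Bc by blast
  then have "Y *\<^sub>v b = 0\<^sub>v n" using split Bc by simp
  then have b0: "b = 0\<^sub>v q" using inj ab by blast
  have colsB: "cols B = ss" using ss Ssub cols by (simp add: B_def)
  have a0: "a = 0\<^sub>v r"
    using lin_depI[OF B ab(1) _ Ba] colsB ss Ssub by auto
  have cab: "c = a @\<^sub>v b" using c(1) by (simp add: a_def b_def)
  have "c = 0\<^sub>v (r + q)" unfolding cab a0 b0 by (intro eq_vecI) auto
  with c(2) show False by contradiction
qed

section \<open>Quadratic forms of graphs\<close>

lemma enumeration:
  assumes "finite S"
  shows "distinct (enumeration S)" "set (enumeration S) = S" "length (enumeration S) = card S"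
proof -
  obtain xs where "distinct xs \<and> set xs = S" using finite_distinct_list[OF assms] by auto
  then have "distinct (enumeration S) \<and> set (enumeration S) = S"
    unfolding enumeration_def by (rule someI[of "\<lambda>xs. distinct xs \<and> set xs = S"])
  then show "distinct (enumeration S)" "set (enumeration S) = S" by auto
  then show "length (enumeration S) = card S" using distinct_card by metis
qed

lemma bij_betw_enumeration: "finite S \<Longrightarrow> bij_betw ((!) (enumeration S)) {..<card S} S"
  using bij_betw_nth[of "enumeration S" "{..<card S}" S] enumeration[of S] by auto

lemma sum_enumeration: "finite S \<Longrightarrow> (\<Sum>i<card S. g (enumeration S ! i)) = (\<Sum>v\<in>S. g v)"
  using sum.reindex_bij_betw[OF bij_betw_enumeration] .

lemma edge_ends:
  assumes "card e = 2"
  shows "e = {fst (edge_ends e), snd (edge_ends e)}" "fst (edge_ends e) \<noteq> snd (edge_ends e)"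
proof -
  obtain u v where "e = {u, v}" using assms by (auto simp: card_2_iff)
  then have "case edge_ends e of (u, v) \<Rightarrow> e = {u, v}"
    unfolding edge_ends_def using someI[of "\<lambda>(u, v). e = {u, v}" "(u, v)"] by simp
  then show *: "e = {fst (edge_ends e), snd (edge_ends e)}" by (simp add: case_prod_beta)
  show "fst (edge_ends e) \<noteq> snd (edge_ends e)"
  proof
    assume "fst (edge_ends e) = snd (edge_ends e)"
    with * have "e = {snd (edge_ends e)}" by simp
    then have "card e = 1" by (metis card_1_singleton_iff One_nat_def)
    with assms show False by simp
  qed
qed

lemma finite_simple_graph_edge:
  assumes "finite_simple_graph H" "e \<in> snd H"
  shows "e = {fst (edge_ends e), snd (edge_ends e)}" "fst (edge_ends e) \<noteq> snd (edge_ends e)"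
    "fst (edge_ends e) \<in> fst H" "snd (edge_ends e) \<in> fst H"
proof -
  have e: "e \<subseteq> fst H" "card e = 2" using assms by (auto simp: finite_simple_graph_def)
  note ends = edge_ends[OF e(2)]
  show "e = {fst (edge_ends e), snd (edge_ends e)}" "fst (edge_ends e) \<noteq> snd (edge_ends e)"
    by (rule ends)+
  show "fst (edge_ends e) \<in> fst H" "snd (edge_ends e) \<in> fst H" using e(1) ends(1) by blast+
qed

lemma finite_simple_graph_finite:
  assumes "finite_simple_graph H"
  shows "finite (fst H)" "finite (snd H)"
proof -
  show "finite (fst H)" using assms by (simp add: finite_simple_graph_def)
  then show "finite (snd H)"
    using assms by (auto simp: finite_simple_graph_def intro: finite_subset[of _ "Pow (fst H)"])
qed

text \<open>The row order is that of \<open>rigidity_matrix\<close>, which lets sums over numeric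
  indices become sums over vertices and coordinates. With \<open>d = 1\<close> the same encoding
  serves for functions on the vertices, on which the Laplacian acts, and for coefficients indexed by
  any finite set.\<close>

definition config_vec :: "nat \<Rightarrow> 'a set \<Rightarrow> ('a \<Rightarrow> nat \<Rightarrow> real) \<Rightarrow> real vec" where
  "config_vec d V X = vec (d * card V) (\<lambda>r. X (enumeration V ! (r div d)) (r mod d))"

lemma config_vec_carrier [simp]: "config_vec d V X \<in> carrier_vec (d * card V)"
  by (simp add: config_vec_def)

lemma sum_div_mod:
  fixes h :: "nat \<Rightarrow> nat \<Rightarrow> 'b :: comm_monoid_add"
  shows "(\<Sum>r<d * n. h (r div d) (r mod d)) = (\<Sum>i<n. \<Sum>k<d. h i k)"
proof (induction n)
  case (Suc n)
  have "(\<Sum>r<d * n + m. g r) = (\<Sum>r<d * n. g r) + (\<Sum>k<m. g (d * n + k))"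
    for g :: "nat \<Rightarrow> 'b" and m
    by (induction m) (auto simp: add.assoc)
  from this[of "\<lambda>r. h (r div d) (r mod d)" d] Suc show ?case
    by (simp add: add.commute)
qed simp

lemma sum_config:
  assumes "finite V"
  shows "(\<Sum>r<d * card V. h (enumeration V ! (r div d)) (r mod d)) = (\<Sum>v\<in>V. \<Sum>k<d. h v k)"
  using sum_div_mod[of "\<lambda>i. h (enumeration V ! i)" d "card V"]
    sum_enumeration[OF assms, of "\<lambda>v. \<Sum>k<d. h v k"] by simp

lemma config_vec_scalar_prod:
  assumes "finite V"
  shows "config_vec d V X \<bullet> config_vec d V Y = (\<Sum>v\<in>V. \<Sum>k<d. X v k * Y v k)"
  using sum_config[OF assms, where h = "\<lambda>v k. X v k * Y v k"]
  by (simp add: config_vec_def scalar_prod_def atLeast0LessThan)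

lemma config_vec_exhaust:
  assumes "finite V" "x \<in> carrier_vec (d * card V)"
  obtains X where "x = config_vec d V X"
proof
  let ?i = "the_inv_into {..<card V} ((!) (enumeration V))"
  have inj: "inj_on ((!) (enumeration V)) {..<card V}"
    using bij_betw_enumeration[OF assms(1)] by (simp add: bij_betw_def)
  show "x = config_vec d V (\<lambda>v k. x $ (d * ?i v + k))"
  proof (rule eq_vecI)
    fix r assume "r < dim_vec (config_vec d V (\<lambda>v k. x $ (d * ?i v + k)))"
    then have r: "r < d * card V" by (simp add: config_vec_def)
    then have "r div d < card V" by (metis less_mult_imp_div_less mult.commute)
    then have "?i (enumeration V ! (r div d)) = r div d"
      using the_inv_into_f_f[OF inj] by blast
    then show "x $ r = config_vec d V (\<lambda>v k. x $ (d * ?i v + k)) $ r"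
      using r by (simp add: config_vec_def)
  qed (use assms in \<open>simp add: config_vec_def\<close>)
qed

lemma config_vec_eq_0_iff:
  assumes "finite V"
  shows "config_vec d V X = 0\<^sub>v (d * card V) \<longleftrightarrow> (\<forall>v\<in>V. \<forall>k<d. X v k = 0)"
proof -
  have "config_vec d V X \<bullet> config_vec d V X = (\<Sum>v\<in>V. \<Sum>k<d. (X v k)\<^sup>2)"
    unfolding config_vec_scalar_prod[OF assms] by (simp add: power2_eq_square)
  then have "config_vec d V X = 0\<^sub>v (d * card V) \<longleftrightarrow> (\<Sum>v\<in>V. \<Sum>k<d. (X v k)\<^sup>2) = 0"
    using real_scalar_prod_self_eq_0[OF config_vec_carrier, of d V X] by argo
  also have "\<dots> \<longleftrightarrow> (\<forall>v\<in>V. \<forall>k<d. X v k = 0)"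
    using assms by (auto simp: sum_nonneg_eq_0_iff sum_nonneg)
  finally show ?thesis .
qed

section \<open>Laplacian forms and algebraic connectivity\<close>

text \<open>The Dirichlet energy of \<open>f\<close>. The square makes the arbitrary orientation
  chosen by \<open>edge_ends\<close> harmless.\<close>

definition edge_energy :: "'a set set \<Rightarrow> ('a \<Rightarrow> real) \<Rightarrow> real" where
  "edge_energy E f = (\<Sum>e\<in>E. (f (fst (edge_ends e)) - f (snd (edge_ends e)))\<^sup>2)"

lemma edge_energy_nonneg: "edge_energy E f \<ge> 0"
  by (simp add: edge_energy_def sum_nonneg)

lemma laplacian_carrier [simp]: "laplacian H \<in> carrier_mat (card (fst H)) (card (fst H))"
  by (simp add: laplacian_def Let_def)

lemma laplacian_symmetric: "transpose_mat (laplacian H) = laplacian H"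
  by (rule eq_matI) (auto simp: laplacian_def Let_def insert_commute)

text \<open>The Laplacian is the sum over the edges of \<open>b e u * b e v\<close>, with
  \<open>b e\<close> the signed incidence vector of \<open>e\<close>. Exchanging the sums turns the
  form into a sum of squares, one for each edge.\<close>

lemma laplacian_quadratic_form:
  assumes H: "finite_simple_graph H"
  shows "config_vec 1 (fst H) (\<lambda>v _. f v) \<bullet> (laplacian H *\<^sub>v config_vec 1 (fst H) (\<lambda>v _. f v)) =
    edge_energy (snd H) f"
proof -
  let ?V = "fst H" and ?E = "snd H"
  let ?vs = "enumeration ?V" and ?n = "card (fst H)"
  note fin = finite_simple_graph_finite[OF H]
  define b :: "'a set \<Rightarrow> 'a \<Rightarrow> real" where
    "b e w = of_bool (w = fst (edge_ends e)) - of_bool (w = snd (edge_ends e))" for e w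
  define L where "L u v = (if u = v then real (card {e \<in> ?E. u \<in> e})
    else if {u, v} \<in> ?E then - 1 else 0)" for u v
  have L: "L u v = (\<Sum>e\<in>?E. b e u * b e v)" for u v
  proof (cases "u = v")
    case True
    have "b e u * b e u = of_bool (u \<in> e)" if "e \<in> ?E" for e
    proof -
      obtain x y where xy: "fst (edge_ends e) = x" "snd (edge_ends e) = y" by blast
      have "e = {x, y}" "x \<noteq> y" using finite_simple_graph_edge(1,2)[OF H that] unfolding xy by auto
      then show ?thesis unfolding b_def xy by auto
    qed
    then have "(\<Sum>e\<in>?E. b e u * b e v) = (\<Sum>e\<in>?E. of_bool (u \<in> e))" using True by simp
    also have "\<dots> = L u v" using fin True by (simp add: L_def of_bool_def sum.If_cases Int_def)
    finally show ?thesis by simp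
  next
    case False
    have "b e u * b e v = (if e = {u, v} then - 1 else 0)" if "e \<in> ?E" for e
    proof -
      obtain x y where xy: "fst (edge_ends e) = x" "snd (edge_ends e) = y" by blast
      have "e = {x, y}" "x \<noteq> y" using finite_simple_graph_edge(1,2)[OF H that] unfolding xy by auto
      then show ?thesis using False unfolding b_def xy by (auto simp: doubleton_eq_iff of_bool_def)
    qed
    then have "(\<Sum>e\<in>?E. b e u * b e v) = (\<Sum>e\<in>?E. if e = {u, v} then - 1 else 0)" by simp
    also have "\<dots> = L u v" using fin False by (simp add: L_def)
    finally show ?thesis by simp
  qed
  have entry: "laplacian H $$ (i, j) = L (?vs ! i) (?vs ! j)" if "i < ?n" "j < ?n" for i j
    using that enumeration[OF fin(1)] by (auto simp: laplacian_def Let_def L_def nth_eq_iff_index_eq)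
  have "config_vec 1 ?V (\<lambda>v _. f v) \<bullet> (laplacian H *\<^sub>v config_vec 1 ?V (\<lambda>v _. f v)) =
      (\<Sum>i<?n. f (?vs ! i) * (\<Sum>j<?n. laplacian H $$ (i, j) * f (?vs ! j)))"
    by (simp add: config_vec_def scalar_prod_def atLeast0LessThan laplacian_def Let_def)
  also have "\<dots> = (\<Sum>i<?n. f (?vs ! i) * (\<Sum>j<?n. L (?vs ! i) (?vs ! j) * f (?vs ! j)))"
    by (simp add: entry)
  also have "\<dots> = (\<Sum>i<?n. f (?vs ! i) * (\<Sum>v\<in>?V. L (?vs ! i) v * f v))"
    by (simp only: sum_enumeration[OF fin(1), of "\<lambda>v. L w v * f v" for w])
  also have "\<dots> = (\<Sum>u\<in>?V. f u * (\<Sum>v\<in>?V. L u v * f v))"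
    by (rule sum_enumeration[OF fin(1)])
  also have "\<dots> = (\<Sum>u\<in>?V. \<Sum>v\<in>?V. \<Sum>e\<in>?E. (f u * b e u) * (f v * b e v))"
    by (simp add: L sum_distrib_left sum_distrib_right algebra_simps)
  also have "\<dots> = (\<Sum>u\<in>?V. \<Sum>e\<in>?E. \<Sum>v\<in>?V. (f u * b e u) * (f v * b e v))"
    by (rule sum.cong[OF refl], rule sum.swap)
  also have "\<dots> = (\<Sum>e\<in>?E. \<Sum>u\<in>?V. \<Sum>v\<in>?V. (f u * b e u) * (f v * b e v))"
    by (rule sum.swap)
  also have "\<dots> = (\<Sum>e\<in>?E. (\<Sum>u\<in>?V. f u * b e u)\<^sup>2)"
    by (simp add: power2_eq_square sum_product)
  also have "\<dots> = edge_energy ?E f"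
    unfolding edge_energy_def
  proof (rule sum.cong[OF refl])
    fix e assume e: "e \<in> ?E"
    have "(\<Sum>u\<in>?V. f u * b e u) = (\<Sum>u\<in>?V. if u = fst (edge_ends e) then f u else 0)
        - (\<Sum>u\<in>?V. if u = snd (edge_ends e) then f u else 0)"
      unfolding b_def sum_subtractf[symmetric] by (intro sum.cong) auto
    then show "(\<Sum>u\<in>?V. f u * b e u)\<^sup>2 = (f (fst (edge_ends e)) - f (snd (edge_ends e)))\<^sup>2"
      using fin finite_simple_graph_edge[OF H e] by simp
  qed
  finally show ?thesis .
qed

text \<open>The min-max principle supplies one condition \<open>w\<close> under which the inequality
  holds, but \<open>w\<close> need not be the constant vector. If \<open>w\<close> does not
  annihilate \<open>f\<close>, adding a constant to a multiple of \<open>f\<close> corrects this: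
  the energy does not see the constant, and as \<open>f\<close> has mean zero the constant only
  enlarges the squared norm.\<close>

lemma algebraic_connectivity_poincare:
  assumes H: "finite_simple_graph H" and ne: "fst H \<noteq> {}"
    and c: "ereal c \<le> algebraic_connectivity H" and sum0: "(\<Sum>v\<in>fst H. f v) = 0"
  shows "c * (\<Sum>v\<in>fst H. (f v)\<^sup>2) \<le> edge_energy (snd H) f"
\<comment> \<open>On a single vertex the connectivity is infinite and \<open>c\<close> is arbitrary,
  but mean zero forces \<open>f\<close> to vanish. For \<open>c \<le> 0\<close> the energy is
  nonnegative anyway. Outside these cases the second eigenvalue is positive, as the last
  contradiction below requires.\<close>
proof (cases "card (fst H) = 1 \<or> c \<le> 0")
  case True
  have "c * (\<Sum>v\<in>fst H. (f v)\<^sup>2) \<le> 0"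
  proof (cases "card (fst H) = 1")
    case True
    then obtain v where "fst H = {v}" by (auto simp: card_1_singleton_iff)
    with sum0 show ?thesis by simp
  next
    case False
    with True show ?thesis by (simp add: mult_nonpos_nonneg sum_nonneg)
  qed
  with edge_energy_nonneg[of "snd H" f] show ?thesis by linarith
next
  case False
  let ?V = "fst H" and ?l = "kth_eigenvalue 2 (laplacian H)"
  note fin = finite_simple_graph_finite[OF H]
  have n: "card ?V \<ge> 2" using False ne fin by (metis One_nat_def card_0_eq less_2_cases not_less)
  have l: "c \<le> ?l" "?l > 0" using c False by (auto simp: algebraic_connectivity_def)
  define x where "x g = config_vec 1 ?V (\<lambda>v _. g v)" for g
  have x: "x g \<in> carrier_vec (card ?V)" for g
    using config_vec_carrier[of 1 ?V] by (simp add: x_def)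
  have norm_x: "x g \<bullet> x g = (\<Sum>v\<in>?V. (g v)\<^sup>2)" for g
    by (simp add: x_def config_vec_scalar_prod[OF fin(1)] power2_eq_square)
  have form_x: "x g \<bullet> (laplacian H *\<^sub>v x g) = edge_energy (snd H) g" for g
    unfolding x_def by (rule laplacian_quadratic_form[OF H])
  obtain F where F: "finite F" "F \<subseteq> carrier_vec (card ?V)" "card F < 2"
    "\<And>x. x \<in> carrier_vec (card ?V) \<Longrightarrow> (\<And>f. f \<in> F \<Longrightarrow> f \<bullet> x = 0) \<Longrightarrow>
      ?l * (x \<bullet> x) \<le> x \<bullet> (laplacian H *\<^sub>v x)"
    using kth_eigenvalue_le_on_orthogonal[OF laplacian_carrier laplacian_symmetric, of 2 H] n by auto
  have "?l * (\<Sum>v\<in>?V. (f v)\<^sup>2) \<le> edge_energy (snd H) f"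
  proof (cases "\<forall>w\<in>F. w \<bullet> x f = 0")
    case True
    then show ?thesis using F(4)[OF x[of f]] by (simp add: norm_x form_x)
  next
    case False
    then obtain w where w: "w \<in> F" "w \<bullet> x f \<noteq> 0" by blast
    have "card F = 1" using F(1,3) w by (metis card_0_eq empty_iff less_2_cases One_nat_def)
    then have Fw: "F = {w}" using w(1) by (auto simp: card_1_singleton_iff)
    have wc: "w \<in> carrier_vec (card ?V)" using w F(2) by blast
    \<comment> \<open>Chosen so that \<open>w\<close> annihilates
      \<open>1 + \<beta> * f\<close>.\<close>
    define \<beta> where "\<beta> = - (w \<bullet> x (\<lambda>_. 1)) / (w \<bullet> x f)"
    let ?g = "\<lambda>v. 1 + \<beta> * f v"
    have "x ?g = x (\<lambda>_. 1) + \<beta> \<cdot>\<^sub>v x f"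
      by (rule eq_vecI) (auto simp: x_def config_vec_def)
    then have "w \<bullet> x ?g = w \<bullet> x (\<lambda>_. 1) + \<beta> * (w \<bullet> x f)"
      using wc x by (simp add: scalar_prod_add_distrib[of _ "card ?V"])
    then have "w \<bullet> x ?g = 0" using w(2) by (simp add: \<beta>_def)
    then have "?l * (\<Sum>v\<in>?V. (?g v)\<^sup>2) \<le> edge_energy (snd H) ?g"
      using F(4)[OF x[of ?g]] by (simp add: Fw norm_x form_x)
    moreover have "(\<Sum>v\<in>?V. (?g v)\<^sup>2) = real (card ?V) + \<beta>\<^sup>2 * (\<Sum>v\<in>?V. (f v)\<^sup>2)"
    proof -
      have "(\<Sum>v\<in>?V. (?g v)\<^sup>2) = (\<Sum>v\<in>?V. 1 + 2 * \<beta> * f v + \<beta>\<^sup>2 * (f v)\<^sup>2)"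
        by (intro sum.cong) (auto simp: power2_eq_square algebra_simps)
      also have "\<dots> = real (card ?V) + 2 * \<beta> * (\<Sum>v\<in>?V. f v) + \<beta>\<^sup>2 * (\<Sum>v\<in>?V. (f v)\<^sup>2)"
        by (simp add: sum.distrib sum_distrib_left)
      finally show ?thesis using sum0 by simp
    qed
    moreover have "edge_energy (snd H) ?g = \<beta>\<^sup>2 * edge_energy (snd H) f"
      unfolding edge_energy_def sum_distrib_left
      by (intro sum.cong) (auto simp: power2_eq_square algebra_simps)
    ultimately have ineq: "?l * real (card ?V) + \<beta>\<^sup>2 * (?l * (\<Sum>v\<in>?V. (f v)\<^sup>2)) \<le> \<beta>\<^sup>2 * edge_energy (snd H) f"
      by (simp add: algebra_simps)
    have pos: "?l * real (card ?V) > 0" using l n by simp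
    show ?thesis
    proof (rule ccontr)
      assume "\<not> ?thesis"
      then have "\<beta>\<^sup>2 * edge_energy (snd H) f \<le> \<beta>\<^sup>2 * (?l * (\<Sum>v\<in>?V. (f v)\<^sup>2))"
        by (intro mult_left_mono) auto
      with ineq pos show False by linarith
    qed
  qed
  moreover have "c * (\<Sum>v\<in>?V. (f v)\<^sup>2) \<le> ?l * (\<Sum>v\<in>?V. (f v)\<^sup>2)"
    using l by (intro mult_right_mono sum_nonneg) auto
  ultimately show ?thesis by linarith
qed

text \<open>The min-max principle with the constant vector as its single condition. The witness
  transfers sign information from the energy to the eigenvalue.\<close>

lemma kth_eigenvalue_2_laplacian_witness:
  assumes H: "finite_simple_graph H" and n: "card (fst H) \<ge> 2"
  obtains f where "\<exists>v\<in>fst H. f v \<noteq> 0" "(\<Sum>v\<in>fst H. f v) = 0"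
    "edge_energy (snd H) f \<le> kth_eigenvalue 2 (laplacian H) * (\<Sum>v\<in>fst H. (f v)\<^sup>2)"
proof -
  let ?V = "fst H"
  note fin = finite_simple_graph_finite[OF H]
  let ?one = "config_vec 1 ?V (\<lambda>_ _. 1)"
  have "?one \<in> carrier_vec (card ?V)" using config_vec_carrier[of 1 ?V] by simp
  then obtain x where x: "x \<in> carrier_vec (card ?V)" "x \<noteq> 0\<^sub>v (card ?V)" "?one \<bullet> x = 0"
    "x \<bullet> (laplacian H *\<^sub>v x) \<le> kth_eigenvalue 2 (laplacian H) * (x \<bullet> x)"
    using kth_eigenvalue_max_min[OF laplacian_carrier laplacian_symmetric, of 2 H "{?one}"] n by auto
  obtain X where "x = config_vec 1 ?V X" using config_vec_exhaust[OF fin(1), of x 1] x(1) by auto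
  moreover have "config_vec 1 ?V X = config_vec 1 ?V (\<lambda>v _. X v 0)" by (simp add: config_vec_def)
  ultimately have xf: "x = config_vec 1 ?V (\<lambda>v _. X v 0)" by simp
  show thesis
  proof
    show "\<exists>v\<in>?V. X v 0 \<noteq> 0"
      using x(2) config_vec_eq_0_iff[OF fin(1), of 1 "\<lambda>v _. X v 0"] by (auto simp: xf)
    show "(\<Sum>v\<in>?V. X v 0) = 0"
      using x(3) by (simp add: xf config_vec_scalar_prod[OF fin(1)])
    show "edge_energy (snd H) (\<lambda>v. X v 0) \<le> kth_eigenvalue 2 (laplacian H) * (\<Sum>v\<in>?V. (X v 0)\<^sup>2)"
      using x(4) unfolding xf laplacian_quadratic_form[OF H]
      by (simp add: config_vec_scalar_prod[OF fin(1)] power2_eq_square)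
  qed
qed

lemma algebraic_connectivity_nonneg:
  assumes H: "finite_simple_graph H" and ne: "fst H \<noteq> {}"
  shows "algebraic_connectivity H \<ge> 0"
proof (cases "card (fst H) = 1")
  case False
  note fin = finite_simple_graph_finite[OF H]
  have n: "card (fst H) \<ge> 2" using False ne fin by (metis One_nat_def card_0_eq less_2_cases not_less)
  obtain f where f: "\<exists>v\<in>fst H. f v \<noteq> 0"
    "edge_energy (snd H) f \<le> kth_eigenvalue 2 (laplacian H) * (\<Sum>v\<in>fst H. (f v)\<^sup>2)"
    using kth_eigenvalue_2_laplacian_witness[OF H n] by blast
  have "(\<Sum>v\<in>fst H. (f v)\<^sup>2) > 0"
    using f(1) fin by (meson sum_pos2 zero_le_power2 zero_less_power2)
  with f(2) edge_energy_nonneg[of "snd H" f] have "kth_eigenvalue 2 (laplacian H) \<ge> 0"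
    by (smt (verit) mult_neg_pos)
  with False show ?thesis by (simp add: algebraic_connectivity_def)
qed (simp add: algebraic_connectivity_def)

text \<open>Otherwise the witness would have zero energy and so be constant along edges, hence
  constant by connectedness, and mean zero would make it vanish.\<close>

lemma algebraic_connectivity_pos:
  assumes H: "finite_simple_graph H" and conn: "graph_connected H"
  shows "algebraic_connectivity H > 0"
proof (cases "card (fst H) = 1")
  case False
  note fin = finite_simple_graph_finite[OF H]
  have ne: "fst H \<noteq> {}" using conn by (simp add: graph_connected_def)
  have n: "card (fst H) \<ge> 2" using False ne fin by (metis One_nat_def card_0_eq less_2_cases not_less)
  obtain f where f: "\<exists>v\<in>fst H. f v \<noteq> 0" "(\<Sum>v\<in>fst H. f v) = 0"
    "edge_energy (snd H) f \<le> kth_eigenvalue 2 (laplacian H) * (\<Sum>v\<in>fst H. (f v)\<^sup>2)"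
    using kth_eigenvalue_2_laplacian_witness[OF H n] by blast
  have "kth_eigenvalue 2 (laplacian H) > 0"
  proof (rule ccontr)
    assume "\<not> ?thesis"
    then have "kth_eigenvalue 2 (laplacian H) * (\<Sum>v\<in>fst H. (f v)\<^sup>2) \<le> 0"
      by (intro mult_nonpos_nonneg sum_nonneg) auto
    with f(3) edge_energy_nonneg[of "snd H" f] have "edge_energy (snd H) f = 0" by linarith
    then have eq: "f (fst (edge_ends e)) = f (snd (edge_ends e))" if "e \<in> snd H" for e
      using that fin by (auto simp: edge_energy_def sum_nonneg_eq_0_iff)
    have step: "f u = f v" if "{u, v} \<in> snd H" for u v
      using eq[OF that] finite_simple_graph_edge(1)[OF H that] by (metis doubleton_eq_iff)
    have const: "f u = f v" if "(u, v) \<in> {(x, y). {x, y} \<in> snd H}\<^sup>*" for u v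
      using that by induction (auto dest: step)
    obtain v0 where v0: "v0 \<in> fst H" "f v0 \<noteq> 0" using f(1) by blast
    have "f v = f v0" if "v \<in> fst H" for v
      using conn that v0 const by (auto simp: graph_connected_def)
    then have "(\<Sum>v\<in>fst H. f v) = real (card (fst H)) * f v0" by simp
    with f(2) v0 n show False by simp
  qed
  with False show ?thesis by (simp add: algebraic_connectivity_def)
qed (simp add: algebraic_connectivity_def)

section \<open>Edge stretches and the stiffness form\<close>

text \<open>For distinct positions this is the first-order change of the distance between
  \<open>u\<close> and \<open>v\<close> when the vertices move with velocity \<open>X\<close>. The
  stretches of the edges are the entries of the transposed rigidity matrix applied to
  \<open>X\<close>.\<close>

definition stretch :: "nat \<Rightarrow> ('a \<Rightarrow> real vec) \<Rightarrow> ('a \<Rightarrow> nat \<Rightarrow> real) \<Rightarrow> 'a \<Rightarrow> 'a \<Rightarrow> real" where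
  "stretch d p X u v = (\<Sum>k<d. direction d p u v $ k * (X u k - X v k))"

lemma rigidity_matrix_carrier [simp]:
  "rigidity_matrix d H p \<in> carrier_mat (d * card (fst H)) (card (snd H))"
  by (simp add: rigidity_matrix_def Let_def)

lemma rigidity_matrix_transpose_mult:
  assumes H: "finite_simple_graph H" and c: "c < card (snd H)"
  shows "(transpose_mat (rigidity_matrix d H p) *\<^sub>v config_vec d (fst H) X) $ c =
    (case edge_ends (enumeration (snd H) ! c) of (u, v) \<Rightarrow> stretch d p X u v)"
proof -
  let ?V = "fst H"
  note fin = finite_simple_graph_finite[OF H]
  let ?e = "enumeration (snd H) ! c"
  have e: "?e \<in> snd H" using enumeration[OF fin(2)] c nth_mem by metis
  obtain u v where uv: "edge_ends ?e = (u, v)" by fastforce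
  have V: "u \<in> ?V" "v \<in> ?V" using finite_simple_graph_edge(3,4)[OF H e] uv by auto
  have "(transpose_mat (rigidity_matrix d H p) *\<^sub>v config_vec d ?V X) $ c =
    (\<Sum>r<d * card ?V. (of_bool (enumeration ?V ! (r div d) = u) - of_bool (enumeration ?V ! (r div d) = v))
       * direction d p u v $ (r mod d) * X (enumeration ?V ! (r div d)) (r mod d))"
    using c by (simp add: rigidity_matrix_def config_vec_def Let_def scalar_prod_def uv atLeast0LessThan)
  also have "\<dots> = (\<Sum>w\<in>?V. \<Sum>k<d. (of_bool (w = u) - of_bool (w = v)) * direction d p u v $ k * X w k)"
    by (rule sum_config[OF fin(1)])
  also have "\<dots> = (\<Sum>w\<in>?V. if w = u then \<Sum>k<d. direction d p u v $ k * X u k else 0) -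
      (\<Sum>w\<in>?V. if w = v then \<Sum>k<d. direction d p u v $ k * X v k else 0)"
    unfolding sum_subtractf[symmetric] by (intro sum.cong) (auto simp: sum_negf)
  also have "\<dots> = stretch d p X u v"
    using V fin by (simp add: stretch_def right_diff_distrib sum_subtractf)
  finally show ?thesis by (simp add: uv)
qed

lemma stiffness_matrix_carrier [simp]:
  "stiffness_matrix d H p \<in> carrier_mat (d * card (fst H)) (d * card (fst H))"
  unfolding stiffness_matrix_def
  by (rule mult_carrier_mat[OF rigidity_matrix_carrier]) simp

lemma stiffness_matrix_symmetric: "transpose_mat (stiffness_matrix d H p) = stiffness_matrix d H p"
  unfolding stiffness_matrix_def
  by (subst transpose_mult[OF rigidity_matrix_carrier
        transpose_carrier_mat[THEN iffD2, OF rigidity_matrix_carrier]]) simp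

lemma stiffness_quadratic_form:
  assumes H: "finite_simple_graph H"
  shows "config_vec d (fst H) X \<bullet> (stiffness_matrix d H p *\<^sub>v config_vec d (fst H) X) =
    (\<Sum>e\<in>snd H. (stretch d p X (fst (edge_ends e)) (snd (edge_ends e)))\<^sup>2)"
proof -
  let ?R = "rigidity_matrix d H p" and ?x = "config_vec d (fst H) X"
  have R: "?R \<in> carrier_mat (d * card (fst H)) (card (snd H))"
    "transpose_mat ?R \<in> carrier_mat (card (snd H)) (d * card (fst H))" by simp_all
  let ?y = "transpose_mat ?R *\<^sub>v ?x"
  have y: "?y \<in> carrier_vec (card (snd H))"
    by (rule mult_mat_vec_carrier[OF R(2) config_vec_carrier])
  have "?x \<bullet> (stiffness_matrix d H p *\<^sub>v ?x) = ?x \<bullet> (?R *\<^sub>v ?y)"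
    unfolding stiffness_matrix_def by (simp add: assoc_mult_mat_vec[OF R])
  also have "\<dots> = ?y \<bullet> ?y"
    using transpose_vec_mult_scalar[OF R(1) y, of ?x] by simp
  also have "\<dots> = (\<Sum>c<card (snd H). (?y $ c)\<^sup>2)"
    by (simp only: real_scalar_prod_self carrier_vecD[OF y])
  also have "\<dots> = (\<Sum>c<card (snd H). (stretch d p X (fst (edge_ends (enumeration (snd H) ! c)))
      (snd (edge_ends (enumeration (snd H) ! c))))\<^sup>2)"
    using rigidity_matrix_transpose_mult[OF H] 
    by (intro sum.cong) (auto simp: case_prod_beta simp del: index_mult_mat_vec)
  also have "\<dots> = (\<Sum>e\<in>snd H. (stretch d p X (fst (edge_ends e)) (snd (edge_ends e)))\<^sup>2)"
    by (rule sum_enumeration[OF finite_simple_graph_finite(2)[OF H]])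
  finally show ?thesis .
qed

section \<open>Frameworks\<close>

lemma square_sum_le_card_mult_sum_squares:
  fixes x :: "nat \<Rightarrow> real"
  shows "(\<Sum>k<d. x k)\<^sup>2 \<le> real d * (\<Sum>k<d. (x k)\<^sup>2)"
proof (cases "d = 0")
  case False
  let ?S = "\<Sum>k<d. x k"
  have "0 \<le> (\<Sum>k<d. (real d * x k - ?S)\<^sup>2)" by (intro sum_nonneg) auto
  also have "\<dots> = (\<Sum>k<d. (real d)\<^sup>2 * (x k)\<^sup>2 - 2 * real d * ?S * x k + ?S\<^sup>2)"
    by (intro sum.cong) (auto simp: power2_eq_square algebra_simps)
  also have "\<dots> = (real d)\<^sup>2 * (\<Sum>k<d. (x k)\<^sup>2) - 2 * real d * ?S * ?S + real d * ?S\<^sup>2"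
    by (simp add: sum.distrib sum_subtractf sum_distrib_left)
  also have "\<dots> = real d * (real d * (\<Sum>k<d. (x k)\<^sup>2) - ?S\<^sup>2)"
    by (simp add: power2_eq_square algebra_simps)
  finally show ?thesis using False by (simp add: zero_le_mult_iff)
qed simp

lemma sum_squares_le_simplex_form:
  fixes x :: "nat \<Rightarrow> real"
  assumes "d > 0"
  shows "(\<Sum>k<d. (x k)\<^sup>2) \<le> (\<Sum>k<d. x k)\<^sup>2 / real d + (\<Sum>k<d. (y - x k)\<^sup>2)"
proof -
  let ?S = "\<Sum>k<d. x k"
  have "(\<Sum>k<d. (y - x k)\<^sup>2) = (\<Sum>k<d. y\<^sup>2 - 2 * y * x k + (x k)\<^sup>2)"
    by (intro sum.cong) (auto simp: power2_eq_square algebra_simps)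
  also have "\<dots> = real d * y\<^sup>2 - 2 * y * ?S + (\<Sum>k<d. (x k)\<^sup>2)"
    by (simp add: sum.distrib sum_subtractf sum_distrib_left)
  finally have sum_eq: "(\<Sum>k<d. (y - x k)\<^sup>2) = real d * y\<^sup>2 - 2 * y * ?S + (\<Sum>k<d. (x k)\<^sup>2)" .
  have "?S\<^sup>2 / real d + (\<Sum>k<d. (y - x k)\<^sup>2) = (?S - real d * y)\<^sup>2 / real d + (\<Sum>k<d. (x k)\<^sup>2)"
    unfolding sum_eq using assms by (simp add: power2_eq_square field_simps)
  moreover have "(?S - real d * y)\<^sup>2 / real d \<ge> 0" by simp
  ultimately show ?thesis by linarith
qed

text \<open>For an edge between parts, \<open>a\<close> and \<open>S\<close> are the inner products
  of the relative displacement with e_i - e_j and (1,...,1), and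
  \<open>2 + d * \<sigma>\<^sup>2\<close> is the squared norm of the tilted edge vector. After
  clearing the denominator, its excess over 2 costs at most
  \<open>d * \<bar>\<sigma>\<bar> * W\<close> and the cross term at most
  \<open>(d + 2) * \<bar>\<sigma>\<bar> * W\<close>. Half of the total is the constant
  \<open>d + 1\<close>.\<close>

lemma tilted_direction_bound:
  fixes a S W \<sigma> :: real and d :: nat
  assumes a: "a\<^sup>2 \<le> 2 * W" and S: "S\<^sup>2 \<le> real d * W" and \<sigma>: "\<bar>\<sigma>\<bar> \<le> 1" and W: "W \<ge> 0"
  shows "a\<^sup>2 / 2 - real (d + 1) * \<bar>\<sigma>\<bar> * W \<le> (a + \<sigma> * S)\<^sup>2 / (2 + real d * \<sigma>\<^sup>2)"
proof -
  have s2: "\<sigma>\<^sup>2 \<le> \<bar>\<sigma>\<bar>"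
    using mult_left_le[OF \<sigma>, of "\<bar>\<sigma>\<bar>"] by (simp add: power2_eq_square)
  have pos: "2 + real d * \<sigma>\<^sup>2 > 0" by (smt (verit) of_nat_0_le_iff mult_nonneg_nonneg zero_le_power2)
  have "(2 + real d * \<sigma>\<^sup>2) * (a\<^sup>2 / 2 - real (d + 1) * \<bar>\<sigma>\<bar> * W) =
      a\<^sup>2 + real d * \<sigma>\<^sup>2 * (a\<^sup>2 / 2) - 2 * (real (d + 1) * \<bar>\<sigma>\<bar> * W)
        - real d * \<sigma>\<^sup>2 * (real (d + 1) * \<bar>\<sigma>\<bar> * W)"
    by (simp add: algebra_simps)
  also have "\<dots> \<le> a\<^sup>2 + real d * \<bar>\<sigma>\<bar> * W - 2 * (real (d + 1) * \<bar>\<sigma>\<bar> * W)"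
  proof -
    have "real d * \<sigma>\<^sup>2 * (a\<^sup>2 / 2) \<le> real d * \<bar>\<sigma>\<bar> * W"
      using a s2 W by (intro mult_mono) (auto intro: mult_left_mono)
    moreover have "0 \<le> real d * \<sigma>\<^sup>2 * (real (d + 1) * \<bar>\<sigma>\<bar> * W)" using W by simp
    ultimately show ?thesis by linarith
  qed
  also have "\<dots> = a\<^sup>2 - \<bar>\<sigma>\<bar> * (2 * W + real d * W)" by (simp add: algebra_simps)
  also have "\<dots> \<le> a\<^sup>2 - \<bar>\<sigma>\<bar> * (a\<^sup>2 + S\<^sup>2)"
    using a S by (intro diff_left_mono mult_left_mono) auto
  also have "\<dots> \<le> a\<^sup>2 - 2 * \<bar>\<sigma>\<bar> * (\<bar>a\<bar> * \<bar>S\<bar>)"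
  proof -
    have "2 * (\<bar>a\<bar> * \<bar>S\<bar>) \<le> a\<^sup>2 + S\<^sup>2"
      using sum_squares_bound[of "\<bar>a\<bar>" "\<bar>S\<bar>"] by simp
    then have "\<bar>\<sigma>\<bar> * (2 * (\<bar>a\<bar> * \<bar>S\<bar>)) \<le> \<bar>\<sigma>\<bar> * (a\<^sup>2 + S\<^sup>2)"
      by (rule mult_left_mono) simp
    then show ?thesis by simp
  qed
  also have "\<dots> \<le> a\<^sup>2 + 2 * (a * (\<sigma> * S))"
    using abs_ge_minus_self[of "a * (\<sigma> * S)"] by (simp add: abs_mult mult_ac)
  also have "\<dots> \<le> (a + \<sigma> * S)\<^sup>2" by (simp add: power2_sum)
  finally show ?thesis using pos by (simp add: pos_le_divide_eq mult.commute)
qed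

lemma stretch_square:
  assumes "p u \<in> carrier_vec d" "p v \<in> carrier_vec d" "p u \<noteq> p v"
  shows "(stretch d p X u v)\<^sup>2 = (\<Sum>k<d. (p u $ k - p v $ k) * (X u k - X v k))\<^sup>2 / (\<Sum>k<d. (p u $ k - p v $ k)\<^sup>2)"
proof -
  let ?N = "(p u - p v) \<bullet> (p u - p v)"
  have N: "?N = (\<Sum>k<d. (p u $ k - p v $ k)\<^sup>2)"
    using assms by (simp add: real_scalar_prod_self)
  then have "?N \<ge> 0" by (simp add: sum_nonneg)
  have "stretch d p X u v = (\<Sum>k<d. (p u $ k - p v $ k) * (X u k - X v k)) / sqrt ?N"
    unfolding stretch_def sum_divide_distrib using assms by (intro sum.cong) (auto simp: direction_def)
  then show ?thesis using \<open>?N \<ge> 0\<close> by (simp add: power_divide N)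
qed

lemma stretch_eq_0I:
  assumes "p u \<in> carrier_vec d" "p v \<in> carrier_vec d"
    and "(\<Sum>k<d. (p u $ k - p v $ k) * (X u k - X v k)) = 0"
  shows "stretch d p X u v = 0"
proof (cases "p u = p v")
  case True
  then show ?thesis by (simp add: stretch_def direction_def)
next
  case False
  then have "(stretch d p X u v)\<^sup>2 = 0" using stretch_square[of p u d v X] assms by simp
  then show ?thesis by simp
qed

section \<open>Trivial motions\<close>

text \<open>A common index set for two families of the same size: the balance conditions, where (i,
  i) stands for a part and (i, j) for a pair of parts, and the trivial motions, where (a, a) stands
  for a translation and (a, b) for a rotation.\<close>

definition ordered_pairs :: "nat \<Rightarrow> (nat \<times> nat) set" where
  "ordered_pairs d = {(i, j). i \<le> j \<and> j < d}"

lemma finite_ordered_pairs [simp]: "finite (ordered_pairs d)"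
  by (rule finite_subset[of _ "{..<d} \<times> {..<d}"]) (auto simp: ordered_pairs_def)

lemma card_ordered_pairs: "card (ordered_pairs d) = (d + 1) choose 2"
proof (induction d)
  case (Suc d)
  have "ordered_pairs (Suc d) = ordered_pairs d \<union> (\<lambda>i. (i, d)) ` {..d}"
    by (auto simp: ordered_pairs_def)
  moreover have "card ((\<lambda>i. (i, d)) ` {..d}) = Suc d" by (subst card_image) (auto simp: inj_on_def)
  moreover have "ordered_pairs d \<inter> (\<lambda>i. (i, d)) ` {..d} = {}" by (auto simp: ordered_pairs_def)
  ultimately have "card (ordered_pairs (Suc d)) = card (ordered_pairs d) + Suc d"
    by (simp add: card_Un_disjoint)
  then show ?case using Suc by (simp add: numeral_2_eq_2)
qed (simp add: ordered_pairs_def)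

lemma sum_ordered_pairs:
  "(\<Sum>(a, b)\<in>ordered_pairs d. h a b) = (\<Sum>a<d. \<Sum>b<d. if a \<le> b then h a b else 0)"
proof -
  have "(\<Sum>a<d. \<Sum>b<d. if a \<le> b then h a b else 0) =
      (\<Sum>(a, b)\<in>{..<d} \<times> {..<d}. if a \<le> b then h a b else 0)"
    by (simp add: sum.cartesian_product)
  also have "\<dots> = (\<Sum>(a, b)\<in>ordered_pairs d. h a b)"
    by (rule sum.mono_neutral_cong_right) (auto simp: ordered_pairs_def split: if_splits)
  finally show ?thesis by simp
qed

text \<open>For a < b an infinitesimal rotation in the plane of the axes a and b, for a = b a translation.\<close>

definition trivial_motion :: "('a \<Rightarrow> real vec) \<Rightarrow> nat \<times> nat \<Rightarrow> 'a \<Rightarrow> nat \<Rightarrow> real" where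
  "trivial_motion p = (\<lambda>(a, b) v k. if a = b then of_bool (k = a)
     else of_bool (k = a) * p v $ b - of_bool (k = b) * p v $ a)"

text \<open>A translation cancels in the relative displacement. A rotation acts on the edge vector
  by a skew-symmetric matrix, whose quadratic form is zero.\<close>

lemma stretch_trivial_motion:
  assumes "p u \<in> carrier_vec d" "p v \<in> carrier_vec d" "ab \<in> ordered_pairs d"
  shows "stretch d p (trivial_motion p ab) u v = 0"
proof (rule stretch_eq_0I[of p u d v, OF assms(1,2)])
  obtain a b where ab: "ab = (a, b)" "a \<le> b" "b < d" using assms(3) by (auto simp: ordered_pairs_def)
  let ?z = "\<lambda>k. p u $ k - p v $ k"
  show "(\<Sum>k<d. ?z k * (trivial_motion p ab u k - trivial_motion p ab v k)) = 0"
  proof (cases "a = b")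
    case True
    then show ?thesis by (simp add: ab trivial_motion_def)
  next
    case False
    then have "(\<Sum>k<d. ?z k * (trivial_motion p ab u k - trivial_motion p ab v k)) =
        (\<Sum>k<d. (if k = a then ?z k * ?z b else 0) - (if k = b then ?z k * ?z a else 0))"
      by (intro sum.cong) (auto simp: ab trivial_motion_def algebra_simps)
    also have "\<dots> = ?z a * ?z b - ?z b * ?z a"
      using ab by (simp add: sum_subtractf)
    finally show ?thesis by simp
  qed
qed

text \<open>A combination of trivial motions is an affine map evaluated at the position of
  \<open>v\<close>: the diagonal coefficients form the translation vector, the others a
  skew-symmetric matrix.\<close>

lemma sum_trivial_motion:
  assumes "k < d"
  shows "(\<Sum>ab\<in>ordered_pairs d. trivial_motion p ab v k * \<gamma> ab) =
    \<gamma> (k, k) + (\<Sum>b<d. (if k < b then \<gamma> (k, b) else if b < k then - \<gamma> (b, k) else 0) * p v $ b)"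
proof -
  let ?T1 = "\<lambda>a b. if a = b then \<gamma> (a, a) else if a < b then \<gamma> (a, b) * p v $ b else 0"
  let ?T2 = "\<lambda>a b. if a < b then \<gamma> (a, b) * p v $ a else 0"
  have "(\<Sum>ab\<in>ordered_pairs d. trivial_motion p ab v k * \<gamma> ab) =
      (\<Sum>(a, b)\<in>ordered_pairs d. trivial_motion p (a, b) v k * \<gamma> (a, b))"
    by (simp add: case_prod_beta)
  also have "\<dots> = (\<Sum>a<d. \<Sum>b<d. if a \<le> b then trivial_motion p (a, b) v k * \<gamma> (a, b) else 0)"
    by (rule sum_ordered_pairs)
  also have "\<dots> = (\<Sum>a<d. \<Sum>b<d. (if a = k then ?T1 a b else 0) - (if b = k then ?T2 a b else 0))"
    by (intro sum.cong) (auto simp: trivial_motion_def)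
  also have "\<dots> = (\<Sum>a<d. if a = k then \<Sum>b<d. ?T1 a b else 0) - (\<Sum>a<d. \<Sum>b<d. if b = k then ?T2 a b else 0)"
    unfolding sum_subtractf by (intro arg_cong2[where f = "(-)"] sum.cong) auto
  also have "\<dots> = (\<Sum>b<d. ?T1 k b) - (\<Sum>a<d. ?T2 a k)"
    using assms by simp
  also have "\<dots> = (\<Sum>b<d. (if b = k then \<gamma> (k, k) else 0) +
      (if k < b then \<gamma> (k, b) else if b < k then - \<gamma> (b, k) else 0) * p v $ b)"
    unfolding sum_subtractf[symmetric] by (intro sum.cong) auto
  also have "\<dots> = \<gamma> (k, k) + (\<Sum>b<d. (if k < b then \<gamma> (k, b) else if b < k then - \<gamma> (b, k) else 0) * p v $ b)"
    using assms by (simp add: sum.distrib)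
  finally show ?thesis .
qed

section \<open>The tilted simplex framework\<close>

text \<open>The partition is a coloring by 0, ..., d - 1, so that the color of a vertex is also the
  index of the unit vector near which it is placed. Surjectivity says that no part is empty.\<close>

locale partitioned_graph =
  fixes d :: nat and V :: "'a set" and E :: "'a set set" and \<kappa> :: "'a \<Rightarrow> nat"
  assumes d_ge_2: "d \<ge> 2" and graph: "finite_simple_graph (V, E)"
    and colors: "\<kappa> ` V = {..<d}"
begin

abbreviation part :: "nat \<Rightarrow> 'a set" where
  "part i \<equiv> {v \<in> V. \<kappa> v = i}"

lemma finite_V [simp]: "finite V" and finite_E [simp]: "finite E"
  using finite_simple_graph_finite[OF graph] by auto

lemma color_less: "v \<in> V \<Longrightarrow> \<kappa> v < d"
  using colors by auto

lemma part_nonempty: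
  assumes "i < d"
  shows "part i \<noteq> {}"
proof -
  have "i \<in> \<kappa> ` V" unfolding colors using assms by simp
  then show ?thesis by blast
qed

lemma edge:
  assumes "e \<in> E"
  shows "e = {fst (edge_ends e), snd (edge_ends e)}" "fst (edge_ends e) \<noteq> snd (edge_ends e)"
    "fst (edge_ends e) \<in> V" "snd (edge_ends e) \<in> V"
  by (fact finite_simple_graph_edge[OF graph, unfolded fst_conv snd_conv, OF assms])+

lemma induced_graph: "finite_simple_graph (induced (V, E) (part i))"
  using graph unfolding finite_simple_graph_def induced_def fst_conv snd_conv by (simp add: subset_iff)

lemma induced_edge:
  assumes "e \<in> snd (induced (V, E) (part i))"
  shows "e \<in> E" "\<kappa> (fst (edge_ends e)) = i" "\<kappa> (snd (edge_ends e)) = i"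
proof -
  show e: "e \<in> E" using assms by (simp add: induced_def)
  have "e \<subseteq> part i" using assms by (simp add: induced_def)
  then show "\<kappa> (fst (edge_ends e)) = i" "\<kappa> (snd (edge_ends e)) = i" using edge(1)[OF e] by blast+
qed

lemma between_edge:
  assumes e: "e \<in> snd (between (V, E) (part i) (part j))" and "i \<noteq> j"
  shows "e \<in> E" "{\<kappa> (fst (edge_ends e)), \<kappa> (snd (edge_ends e))} = {i, j}"
proof -
  show E: "e \<in> E" using e by (simp add: between_def)
  have "card (e \<inter> part i) = 1" "card (e \<inter> part j) = 1" using e by (simp_all add: between_def)
  then have "e \<inter> part i \<noteq> {}" "e \<inter> part j \<noteq> {}" by auto
  then obtain x y where "x \<in> e" "y \<in> e" "\<kappa> x = i" "\<kappa> y = j" by blast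
  then show "{\<kappa> (fst (edge_ends e)), \<kappa> (snd (edge_ends e))} = {i, j}"
    using edge(1)[OF E] \<open>i \<noteq> j\<close> by (metis doubleton_eq_iff empty_iff insert_iff)
qed

lemma between_graph:
  assumes "i \<noteq> j"
  shows "finite_simple_graph (between (V, E) (part i) (part j))"
proof -
  have "e \<subseteq> part i \<union> part j \<and> card e = 2" if e: "e \<in> snd (between (V, E) (part i) (part j))" for e
  proof -
    note b = between_edge[OF e assms]
    have "x \<in> part i \<union> part j" if "x \<in> e" for x
    proof -
      have "x = fst (edge_ends e) \<or> x = snd (edge_ends e)" using edge(1)[OF b(1)] that by blast
      then show ?thesis using edge(3,4)[OF b(1)] b(2) by auto
    qed
    moreover have "card e = 2" using b(1) graph by (auto simp: finite_simple_graph_def)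
    ultimately show ?thesis by blast
  qed
  moreover have "fst (between (V, E) (part i) (part j)) = part i \<union> part j" by (simp add: between_def)
  ultimately show ?thesis unfolding finite_simple_graph_def by (simp add: subset_iff)
qed

text \<open>
  The limit of the squared stretch of an edge in the tilted framework below, as the tilt tends to 0.
\<close>

definition limit_stretch_square :: "('a \<Rightarrow> nat \<Rightarrow> real) \<Rightarrow> 'a \<Rightarrow> 'a \<Rightarrow> real" where
  "limit_stretch_square X u v = (if \<kappa> u = \<kappa> v then ((\<Sum>k<d. X u k) - (\<Sum>k<d. X v k))\<^sup>2 / real d
     else ((X u (\<kappa> u) - X u (\<kappa> v)) - (X v (\<kappa> u) - X v (\<kappa> v)))\<^sup>2 / 2)"

definition tilted :: "('a \<Rightarrow> real) \<Rightarrow> 'a \<Rightarrow> real vec" where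
  "tilted s v = vec d (\<lambda>k. of_bool (k = \<kappa> v) + s v)"

lemma tilted_carrier [simp]: "tilted s v \<in> carrier_vec d"
  by (simp add: tilted_def)

lemma stretch_tilted_ge:
  assumes uv: "u \<in> V" "v \<in> V" and s: "s u \<noteq> s v" "\<bar>s u - s v\<bar> \<le> \<eta>" "\<eta> \<le> 1"
  shows "limit_stretch_square X u v - real (d + 1) * \<eta> * (\<Sum>k<d. (X u k - X v k)\<^sup>2)
    \<le> (stretch d (tilted s) X u v)\<^sup>2"
proof -
  define \<sigma> where "\<sigma> = s u - s v"
  define w where "w k = X u k - X v k" for k
  define W where "W = (\<Sum>k<d. (w k)\<^sup>2)"
  let ?S = "\<Sum>k<d. w k"
  have \<sigma>: "\<sigma> \<noteq> 0" "\<bar>\<sigma>\<bar> \<le> \<eta>" "\<bar>\<sigma>\<bar> \<le> 1" using s by (auto simp: \<sigma>_def)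
  have \<kappa>: "\<kappa> u < d" "\<kappa> v < d" using uv color_less by auto
  have W: "W \<ge> 0" by (simp add: W_def sum_nonneg)
  have z: "tilted s u $ k - tilted s v $ k = of_bool (k = \<kappa> u) - of_bool (k = \<kappa> v) + \<sigma>" if "k < d" for k
    using that by (simp add: tilted_def \<sigma>_def)
  have S: "?S = (\<Sum>k<d. X u k) - (\<Sum>k<d. X v k)" by (simp add: w_def sum_subtractf)
  have dot: "(\<Sum>k<d. (tilted s u $ k - tilted s v $ k) * (X u k - X v k)) = w (\<kappa> u) - w (\<kappa> v) + \<sigma> * ?S"
  proof -
    have "(\<Sum>k<d. (tilted s u $ k - tilted s v $ k) * (X u k - X v k)) =
        (\<Sum>k<d. (if k = \<kappa> u then w k else 0) - (if k = \<kappa> v then w k else 0) + \<sigma> * w k)"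
      by (intro sum.cong) (auto simp: z w_def algebra_simps)
    then show ?thesis using \<kappa> by (simp add: sum.distrib sum_subtractf sum_distrib_left)
  qed
  \<comment> \<open>Between parts, the coordinates \<open>\<kappa> u\<close> and
    \<open>\<kappa> v\<close> contribute \<open>1 + 2 * \<sigma>\<close> and
    \<open>1 - 2 * \<sigma>\<close> besides \<open>\<sigma>\<^sup>2\<close>; the linear terms
    cancel.\<close>
  have norm: "(\<Sum>k<d. (tilted s u $ k - tilted s v $ k)\<^sup>2) = (if \<kappa> u = \<kappa> v then 0 else 2) + real d * \<sigma>\<^sup>2"
  proof -
    have "(\<Sum>k<d. (tilted s u $ k - tilted s v $ k)\<^sup>2) =
        (\<Sum>k<d. (if k = \<kappa> u then (if \<kappa> u = \<kappa> v then 0 else 1 + 2 * \<sigma>) else 0) +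
          (if k = \<kappa> v then (if \<kappa> u = \<kappa> v then 0 else 1 - 2 * \<sigma>) else 0) + \<sigma>\<^sup>2)"
      by (intro sum.cong) (auto simp: z power2_eq_square algebra_simps)
    then show ?thesis using \<kappa> by (simp add: sum.distrib)
  qed
  have "tilted s u \<noteq> tilted s v"
  proof
    assume "tilted s u = tilted s v"
    then have "(if \<kappa> u = \<kappa> v then 0 else 2) + real d * \<sigma>\<^sup>2 = 0" using norm by simp
    moreover have "real d * \<sigma>\<^sup>2 > 0" using \<sigma> d_ge_2 by simp
    ultimately show False by (auto split: if_splits)
  qed
  then have eq: "(stretch d (tilted s) X u v)\<^sup>2 = (w (\<kappa> u) - w (\<kappa> v) + \<sigma> * ?S)\<^sup>2 /
      ((if \<kappa> u = \<kappa> v then 0 else 2) + real d * \<sigma>\<^sup>2)"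
    unfolding dot[symmetric] norm[symmetric] by (intro stretch_square) auto
  have loss: "real (d + 1) * \<bar>\<sigma>\<bar> * W \<le> real (d + 1) * \<eta> * W"
    using \<sigma> W by (intro mult_right_mono mult_left_mono) auto
  have loss0: "0 \<le> real (d + 1) * \<eta> * W" using W \<sigma>(2) by (intro mult_nonneg_nonneg) auto
  show ?thesis
  proof (cases "\<kappa> u = \<kappa> v")
    case True
    \<comment> \<open>Inside a part the edge vector is a multiple of (1,...,1), and
      \<open>\<sigma>\<^sup>2\<close> cancels in the quotient: the limit value is attained
      exactly.\<close>
    then have "(stretch d (tilted s) X u v)\<^sup>2 = limit_stretch_square X u v"
      using \<sigma> d_ge_2 by (simp add: eq limit_stretch_square_def S power_mult_distrib)
    then show ?thesis using loss0 unfolding W_def w_def by linarith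
  next
    case False
    have "(w (\<kappa> u) - w (\<kappa> v))\<^sup>2 \<le> 2 * W"
    proof -
      have "(w (\<kappa> u) - w (\<kappa> v))\<^sup>2 \<le> 2 * ((w (\<kappa> u))\<^sup>2 + (w (\<kappa> v))\<^sup>2)"
        using sum_squares_bound[of "w (\<kappa> u)" "- w (\<kappa> v)"] by (simp add: power2_diff)
      also have "(w (\<kappa> u))\<^sup>2 + (w (\<kappa> v))\<^sup>2 = (\<Sum>k\<in>{\<kappa> u, \<kappa> v}. (w k)\<^sup>2)" using False by simp
      also have "\<dots> \<le> W" unfolding W_def using \<kappa> by (intro sum_mono2) auto
      finally show ?thesis by simp
    qed
    from tilted_direction_bound[OF this square_sum_le_card_mult_sum_squares[of w d, folded W_def] \<sigma>(3) W]
    have "(w (\<kappa> u) - w (\<kappa> v))\<^sup>2 / 2 - real (d + 1) * \<bar>\<sigma>\<bar> * W \<le> (stretch d (tilted s) X u v)\<^sup>2"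
      using False by (simp add: eq)
    moreover have "(w (\<kappa> u) - w (\<kappa> v))\<^sup>2 / 2 = limit_stretch_square X u v"
      using False by (simp add: limit_stretch_square_def w_def algebra_simps)
    ultimately show ?thesis using loss unfolding W_def w_def by linarith
  qed
qed

section \<open>The stretch form on balanced displacements\<close>

definition balanced :: "('a \<Rightarrow> nat \<Rightarrow> real) \<Rightarrow> bool" where
  "balanced X \<longleftrightarrow> (\<forall>i<d. (\<Sum>v\<in>part i. \<Sum>k<d. X v k) = 0) \<and>
     (\<forall>i j. i < j \<and> j < d \<longrightarrow> (\<Sum>v\<in>part i \<union> part j. X v i - X v j) = 0)"

lemma limit_form_ge:
  assumes c: "c \<ge> 0"
    and ind: "\<And>i. i < d \<Longrightarrow> ereal c \<le> algebraic_connectivity (induced (V, E) (part i))"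
    and btw: "\<And>i j. i < j \<Longrightarrow> j < d \<Longrightarrow> ereal (2 * c) \<le> algebraic_connectivity (between (V, E) (part i) (part j))"
    and bal: "balanced X"
  shows "c * (\<Sum>v\<in>V. \<Sum>k<d. (X v k)\<^sup>2) \<le> (\<Sum>e\<in>E. limit_stretch_square X (fst (edge_ends e)) (snd (edge_ends e)))"
proof -
  let ?I = "ordered_pairs d"
  let ?q = "\<lambda>e. limit_stretch_square X (fst (edge_ends e)) (snd (edge_ends e))"
  \<comment> \<open>The classes \<open>F ij\<close> are told apart by the colors of the ends of
    their edges; \<open>\<phi> ij\<close> collects the squares that the connectivity of class
    \<open>ij\<close> controls. The same \<open>c\<close> serves both kinds of class, because the 2
    in \<open>btw\<close> offsets the 1/2 in the limit stretch.\<close>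
  define F where "F ij = (case ij of (i, j) \<Rightarrow> if i = j then snd (induced (V, E) (part i))
    else snd (between (V, E) (part i) (part j)))" for ij
  define \<phi> where "\<phi> ij v = (case ij of (i, j) \<Rightarrow>
     if i = j then of_bool (\<kappa> v = i) * ((\<Sum>k<d. X v k)\<^sup>2 / real d)
     else of_bool (\<kappa> v = i \<or> \<kappa> v = j) * (X v i - X v j)\<^sup>2)" for ij v
  have F_colors: "e \<in> E \<and> {\<kappa> (fst (edge_ends e)), \<kappa> (snd (edge_ends e))} = {i, j}"
    if "e \<in> F (i, j)" for e i j
    using that induced_edge[of e i] between_edge[of e i j] by (auto simp: F_def split: if_splits)
  have F_sub: "F ij \<subseteq> E" for ij using F_colors by (cases ij) blast
  have disj: "F ij \<inter> F kl = {}" if "ij \<in> ?I" "kl \<in> ?I" "ij \<noteq> kl" for ij kl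
  proof -
    obtain i j k l where [simp]: "ij = (i, j)" "kl = (k, l)" by (cases ij, cases kl)
    have "{i, j} \<noteq> {k, l}" using that by (auto simp: ordered_pairs_def doubleton_eq_iff)
    then show ?thesis using F_colors[of _ i j] F_colors[of _ k l] by (simp add: disjoint_iff) metis
  qed
  have part_bound: "c * (\<Sum>v\<in>V. \<phi> ij v) \<le> (\<Sum>e\<in>F ij. ?q e)" if ij: "ij \<in> ?I" for ij
  proof -
    obtain i j where [simp]: "ij = (i, j)" and ij: "i \<le> j" "j < d"
      using ij by (auto simp: ordered_pairs_def)
    show ?thesis
    proof (cases "i = j")
      case True
      let ?f = "\<lambda>v. \<Sum>k<d. X v k" and ?H = "induced (V, E) (part i)"
      have "c * (\<Sum>v\<in>fst ?H. (?f v)\<^sup>2) \<le> edge_energy (snd ?H) ?f"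
        using ind[of i] ij bal part_nonempty[of i] True
        by (intro algebraic_connectivity_poincare[OF induced_graph]) (auto simp: induced_def balanced_def)
      then have "c * (\<Sum>v\<in>part i. (?f v)\<^sup>2) / real d \<le> edge_energy (snd ?H) ?f / real d"
        by (intro divide_right_mono) (auto simp: induced_def)
      also have "edge_energy (snd ?H) ?f / real d = (\<Sum>e\<in>F ij. ?q e)"
        unfolding edge_energy_def sum_divide_distrib
        using True induced_edge[of _ i] by (intro sum.cong) (auto simp: F_def limit_stretch_square_def)
      also have "c * (\<Sum>v\<in>part i. (?f v)\<^sup>2) / real d = c * (\<Sum>v\<in>part i. (?f v)\<^sup>2 / real d)"
        unfolding sum_divide_distrib[symmetric] by simp
      also have "(\<Sum>v\<in>part i. (?f v)\<^sup>2 / real d) = (\<Sum>v\<in>V. \<phi> ij v)"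
        using True by (intro sum.mono_neutral_cong_left) (auto simp: \<phi>_def)
      finally show ?thesis .
    next
      case False
      then have less: "i < j" using ij by simp
      let ?g = "\<lambda>v. X v i - X v j" and ?H = "between (V, E) (part i) (part j)"
      have "2 * c * (\<Sum>v\<in>fst ?H. (?g v)\<^sup>2) \<le> edge_energy (snd ?H) ?g"
        using btw[OF less ij(2)] ij bal part_nonempty[of j] less
        by (intro algebraic_connectivity_poincare[OF between_graph[OF False]])
          (auto simp: between_def balanced_def)
      then have "c * (\<Sum>v\<in>part i \<union> part j. (?g v)\<^sup>2) \<le> edge_energy (snd ?H) ?g / 2"
        by (simp add: between_def)
      also have "edge_energy (snd ?H) ?g / 2 = (\<Sum>e\<in>F ij. ?q e)"
        unfolding edge_energy_def sum_divide_distrib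
      proof (rule sum.cong)
        fix e assume "e \<in> F ij"
        then have "e \<in> snd ?H" using False by (simp add: F_def)
        from between_edge(2)[OF this False]
        consider "\<kappa> (fst (edge_ends e)) = i" "\<kappa> (snd (edge_ends e)) = j"
          | "\<kappa> (fst (edge_ends e)) = j" "\<kappa> (snd (edge_ends e)) = i"
          by (auto simp: doubleton_eq_iff)
        then show "(?g (fst (edge_ends e)) - ?g (snd (edge_ends e)))\<^sup>2 / 2 = ?q e"
        proof cases
          case 1
          then show ?thesis using False by (simp add: limit_stretch_square_def)
        next
          case 2
          have "(a - b - (a' - b'))\<^sup>2 = (b - a - (b' - a'))\<^sup>2" for a b a' b' :: real
            by (simp add: power2_eq_square algebra_simps)
          then show ?thesis using 2 False by (simp add: limit_stretch_square_def)
        qed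
      qed (use False in \<open>simp add: F_def\<close>)
      also have "(\<Sum>v\<in>part i \<union> part j. (?g v)\<^sup>2) = (\<Sum>v\<in>V. \<phi> ij v)"
        using False by (intro sum.mono_neutral_cong_left) (auto simp: \<phi>_def)
      finally show ?thesis .
    qed
  qed
  have vertex: "(\<Sum>k<d. (X v k)\<^sup>2) \<le> (\<Sum>ij\<in>?I. \<phi> ij v)" if v: "v \<in> V" for v
  proof -
    define l where "l = \<kappa> v"
    have l: "l < d" using color_less[OF v] by (simp add: l_def)
    \<comment> \<open>The d pairs that contain the color \<open>l\<close> of \<open>v\<close>. The
      pair for \<open>k = l\<close> is diagonal and carries the coordinate sum, matching the
      vanishing difference at \<open>k = l\<close>.\<close>
    let ?m = "\<lambda>k. (min l k, max l k)"
    have inj: "inj_on ?m {..<d}" by (auto simp: inj_on_def min_def max_def split: if_splits)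
    have "(\<Sum>k<d. (X v k)\<^sup>2) \<le> (\<Sum>k<d. X v k)\<^sup>2 / real d + (\<Sum>k<d. (X v l - X v k)\<^sup>2)"
      using d_ge_2 by (intro sum_squares_le_simplex_form) auto
    also have "\<dots> = (\<Sum>k<d. (if k = l then (\<Sum>k<d. X v k)\<^sup>2 / real d else 0) + (X v l - X v k)\<^sup>2)"
      using l by (simp add: sum.distrib)
    also have "\<dots> = (\<Sum>k<d. \<phi> (?m k) v)"
      by (intro sum.cong) (auto simp: \<phi>_def l_def[symmetric] min_def max_def power2_commute)
    also have "\<dots> = (\<Sum>ij\<in>?m ` {..<d}. \<phi> ij v)"
      by (simp add: sum.reindex[OF inj])
    also have "\<dots> \<le> (\<Sum>ij\<in>?I. \<phi> ij v)"
      using l by (intro sum_mono2[OF finite_ordered_pairs]) (auto simp: ordered_pairs_def \<phi>_def)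
    finally show ?thesis .
  qed
  have "c * (\<Sum>v\<in>V. \<Sum>k<d. (X v k)\<^sup>2) \<le> c * (\<Sum>v\<in>V. \<Sum>ij\<in>?I. \<phi> ij v)"
    using c vertex by (intro mult_left_mono sum_mono) auto
  also have "\<dots> = (\<Sum>ij\<in>?I. c * (\<Sum>v\<in>V. \<phi> ij v))"
    by (subst sum.swap) (simp add: sum_distrib_left)
  also have "\<dots> \<le> (\<Sum>ij\<in>?I. \<Sum>e\<in>F ij. ?q e)"
    by (intro sum_mono part_bound)
  also have "\<dots> = (\<Sum>e\<in>(\<Union>ij\<in>?I. F ij). ?q e)"
    using disj finite_subset[OF F_sub finite_E] by (subst sum.UNION_disjoint) auto
  also have "\<dots> \<le> (\<Sum>e\<in>E. ?q e)"
    using F_sub by (intro sum_mono2) (auto simp: limit_stretch_square_def)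
  finally show ?thesis .
qed

text \<open>The loss on each edge is at most a multiple of the squared norm of the whole
  displacement, so one tilt serves all balanced \<open>X\<close>. Injectivity of \<open>s\<close> is
  exported for the independence of the trivial motions.\<close>

lemma stretch_form_tilted_ge:
  assumes c: "c \<ge> 0"
    and ind: "\<And>i. i < d \<Longrightarrow> ereal c \<le> algebraic_connectivity (induced (V, E) (part i))"
    and btw: "\<And>i j. i < j \<Longrightarrow> j < d \<Longrightarrow> ereal (2 * c) \<le> algebraic_connectivity (between (V, E) (part i) (part j))"
    and \<delta>: "\<delta> > 0"
  obtains s where "inj_on s V"
    "\<And>X. balanced X \<Longrightarrow> (c - \<delta>) * (\<Sum>v\<in>V. \<Sum>k<d. (X v k)\<^sup>2) \<le>
      (\<Sum>e\<in>E. (stretch d (tilted s) X (fst (edge_ends e)) (snd (edge_ends e)))\<^sup>2)"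
proof -
  \<comment> \<open>Each edge loses at most \<open>(d + 1) * \<eta>\<close> times twice the squared
    norm, so all edges together lose at most \<open>\<delta>\<close> times the squared norm. The
    added 1 covers an empty edge set, and the cap at 1 is required by
    \<open>stretch_tilted_ge\<close>.\<close>
  define \<eta> where "\<eta> = min 1 (\<delta> / (2 * real (d + 1) * (real (card E) + 1)))"
  have \<eta>: "\<eta> > 0" "\<eta> \<le> 1" using \<delta> by (auto simp: \<eta>_def)
  have loss: "2 * real (d + 1) * \<eta> * real (card E) \<le> \<delta>"
  proof -
    have "\<eta> \<le> \<delta> / (2 * real (d + 1) * (real (card E) + 1))" by (simp add: \<eta>_def)
    then have "\<eta> * (2 * real (d + 1) * (real (card E) + 1)) \<le> \<delta>"
      by (subst (asm) pos_le_divide_eq) auto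
    moreover have "2 * real (d + 1) * \<eta> \<ge> 0" using \<eta> by simp
    ultimately show ?thesis by (simp add: algebra_simps)
  qed
  obtain t :: "'a \<Rightarrow> nat" where t: "inj_on t V" "t ` V = {0..<card V}"
    using ex_bij_betw_finite_nat[OF finite_V] by (auto simp: bij_betw_def)
  \<comment> \<open>Offsets are spaced by \<open>\<epsilon>\<close> along a numbering of the
    vertices: distinct, and never further apart than \<open>\<eta>\<close>.\<close>
  define \<epsilon> where "\<epsilon> = \<eta> / (real (card V) + 1)"
  have \<epsilon>: "\<epsilon> > 0" "\<epsilon> * (real (card V) + 1) = \<eta>"
    using \<eta> by (auto simp: \<epsilon>_def add_nonneg_eq_0_iff)
  define s where "s v = \<epsilon> * real (t v)" for v
  have s_bound: "\<bar>s u - s v\<bar> \<le> \<eta>" if "u \<in> V" "v \<in> V" for u v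
  proof -
    have "t u \<in> {0..<card V}" "t v \<in> {0..<card V}" unfolding t(2)[symmetric] using that by auto
    then have "\<bar>real (t u) - real (t v)\<bar> \<le> real (card V) + 1" by auto
    then have "\<epsilon> * \<bar>real (t u) - real (t v)\<bar> \<le> \<eta>"
      unfolding \<epsilon>(2)[symmetric] using \<epsilon>(1) by (intro mult_left_mono) auto
    moreover have "\<bar>s u - s v\<bar> = \<epsilon> * \<bar>real (t u) - real (t v)\<bar>"
      unfolding s_def right_diff_distrib[symmetric] abs_mult using \<epsilon>(1) by simp
    ultimately show ?thesis by simp
  qed
  have inj: "inj_on s V" using t(1) \<epsilon>(1) by (auto simp: inj_on_def s_def)
  show thesis
  proof (rule that[OF inj])
    fix X assume bal: "balanced X"
    let ?N = "\<Sum>v\<in>V. \<Sum>k<d. (X v k)\<^sup>2"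
    have edge_loss: "limit_stretch_square X (fst (edge_ends e)) (snd (edge_ends e)) - real (d + 1) * \<eta> * (2 * ?N)
       \<le> (stretch d (tilted s) X (fst (edge_ends e)) (snd (edge_ends e)))\<^sup>2" if e: "e \<in> E" for e
    proof -
      obtain u v where uv: "fst (edge_ends e) = u" "snd (edge_ends e) = v" by blast
      have V: "u \<noteq> v" "u \<in> V" "v \<in> V" using edge[OF e] unfolding uv by auto
      have "(\<Sum>k<d. (X u k - X v k)\<^sup>2) \<le> (\<Sum>k<d. 2 * ((X u k)\<^sup>2 + (X v k)\<^sup>2))"
      proof (rule sum_mono)
        fix k show "(X u k - X v k)\<^sup>2 \<le> 2 * ((X u k)\<^sup>2 + (X v k)\<^sup>2)"
          using sum_squares_bound[of "X u k" "- X v k"] by (simp add: power2_diff)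
      qed
      also have "\<dots> = 2 * (\<Sum>w\<in>{u, v}. \<Sum>k<d. (X w k)\<^sup>2)"
        using V by (simp add: sum_distrib_left[symmetric] sum.distrib)
      also have "\<dots> \<le> 2 * ?N"
        using V by (intro mult_left_mono sum_mono2) (auto intro: sum_nonneg)
      finally have "real (d + 1) * \<eta> * (\<Sum>k<d. (X u k - X v k)\<^sup>2) \<le> real (d + 1) * \<eta> * (2 * ?N)"
        using \<eta> by (intro mult_left_mono) auto
      moreover have "s u \<noteq> s v" using inj V by (auto dest: inj_onD)
      ultimately show ?thesis
        using stretch_tilted_ge[OF V(2,3) _ s_bound[OF V(2,3)] \<eta>(2), of X] unfolding uv by linarith
    qed
    have "(c - \<delta>) * ?N \<le> c * ?N - 2 * real (d + 1) * \<eta> * real (card E) * ?N"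
      using mult_right_mono[OF loss, of ?N] by (simp add: left_diff_distrib sum_nonneg)
    also have "\<dots> \<le> (\<Sum>e\<in>E. limit_stretch_square X (fst (edge_ends e)) (snd (edge_ends e)))
        - 2 * real (d + 1) * \<eta> * real (card E) * ?N"
      using limit_form_ge[OF c ind btw bal] by simp
    also have "\<dots> = (\<Sum>e\<in>E. limit_stretch_square X (fst (edge_ends e)) (snd (edge_ends e)) - real (d + 1) * \<eta> * (2 * ?N))"
      by (simp add: sum_subtractf mult_ac)
    also have "\<dots> \<le> (\<Sum>e\<in>E. (stretch d (tilted s) X (fst (edge_ends e)) (snd (edge_ends e)))\<^sup>2)"
      by (intro sum_mono edge_loss)
    finally show "(c - \<delta>) * ?N \<le> (\<Sum>e\<in>E. (stretch d (tilted s) X (fst (edge_ends e)) (snd (edge_ends e)))\<^sup>2)" .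
  qed
qed

section \<open>From the balance conditions to the eigenvalue bound\<close>

text \<open>The linear conditions of \<open>balanced\<close> written as vectors, which is how the
  min-max principle and the rank bound accept them.\<close>

definition constraint :: "nat \<times> nat \<Rightarrow> real vec" where
  "constraint = (\<lambda>(i, j). config_vec d V (\<lambda>v k. if i = j then of_bool (\<kappa> v = i)
     else of_bool (\<kappa> v = i \<or> \<kappa> v = j) * (of_bool (k = i) - of_bool (k = j))))"

lemma constraint_carrier: "constraint ij \<in> carrier_vec (d * card V)"
  by (cases ij) (simp add: constraint_def)

lemma balancedI:
  assumes orth: "\<And>ij. ij \<in> ordered_pairs d \<Longrightarrow> constraint ij \<bullet> config_vec d V X = 0"
  shows "balanced X"
  unfolding balanced_def
proof (intro conjI allI impI)
  fix i assume "i < d"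
  then have "0 = constraint (i, i) \<bullet> config_vec d V X" using orth[of "(i, i)"] by (simp add: ordered_pairs_def)
  also have "\<dots> = (\<Sum>v\<in>V. \<Sum>k<d. of_bool (\<kappa> v = i) * X v k)"
    by (simp add: constraint_def config_vec_scalar_prod)
  also have "\<dots> = (\<Sum>v\<in>part i. \<Sum>k<d. X v k)"
    by (rule sum.mono_neutral_cong_right) auto
  finally show "(\<Sum>v\<in>part i. \<Sum>k<d. X v k) = 0" by simp
next
  fix i j assume ij: "i < j \<and> j < d"
  then have "0 = constraint (i, j) \<bullet> config_vec d V X" using orth[of "(i, j)"] by (simp add: ordered_pairs_def)
  also have "\<dots> = (\<Sum>v\<in>V. \<Sum>k<d. of_bool (\<kappa> v = i \<or> \<kappa> v = j) * (of_bool (k = i) - of_bool (k = j)) * X v k)"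
    using ij by (simp add: constraint_def config_vec_scalar_prod)
  also have "\<dots> = (\<Sum>v\<in>V. of_bool (\<kappa> v = i \<or> \<kappa> v = j) * (X v i - X v j))"
  proof (rule sum.cong[OF refl])
    fix v
    have "(\<Sum>k<d. of_bool (\<kappa> v = i \<or> \<kappa> v = j) * (of_bool (k = i) - of_bool (k = j)) * X v k) =
        of_bool (\<kappa> v = i \<or> \<kappa> v = j) * (\<Sum>k<d. (if k = i then X v k else 0) - (if k = j then X v k else 0))"
      unfolding sum_distrib_left by (intro sum.cong) auto
    also have "(\<Sum>k<d. (if k = i then X v k else 0) - (if k = j then X v k else 0)) = X v i - X v j"
      using ij by (simp add: sum_subtractf)
    finally show "(\<Sum>k<d. of_bool (\<kappa> v = i \<or> \<kappa> v = j) * (of_bool (k = i) - of_bool (k = j)) * X v k) =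
        of_bool (\<kappa> v = i \<or> \<kappa> v = j) * (X v i - X v j)" .
  qed
  also have "\<dots> = (\<Sum>v\<in>part i \<union> part j. X v i - X v j)"
    by (rule sum.mono_neutral_cong_right) auto
  finally show "(\<Sum>v\<in>part i \<union> part j. X v i - X v j) = 0" by simp
qed

text \<open>Coinciding constraints could only help: both applications ask for at most this many
  conditions.\<close>

lemma card_constraints: "card (constraint ` ordered_pairs d) \<le> (d + 1) choose 2"
  using card_image_le[OF finite_ordered_pairs, of constraint d] by (simp add: card_ordered_pairs)

lemma d_le_card_V: "d \<le> card V"
  using card_image_le[OF finite_V, of \<kappa>] by (simp add: colors)

text \<open>Keeps the eigenvalue index within the dimension, where \<open>kth_eigenvalue\<close> is
  meaningful. The strict inequality comes from \<open>d \<ge> 2\<close>, since for d = 1 the numbers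
  d(d+1)/2 and d^2 agree.\<close>

lemma choose_less_dimension: "(d + 1) choose 2 < d * card V"
proof -
  have "(d + 1) * d < d * d * 2" using d_ge_2 by simp
  then have "(d + 1) choose 2 < d * d" by (simp add: choose_two less_mult_imp_div_less)
  also have "\<dots> \<le> d * card V" using d_le_card_V by simp
  finally show ?thesis .
qed

lemma kth_eigenvalue_stiffness_ge:
  assumes "\<And>X. balanced X \<Longrightarrow> c * (\<Sum>v\<in>V. \<Sum>k<d. (X v k)\<^sup>2) \<le>
      (\<Sum>e\<in>E. (stretch d p X (fst (edge_ends e)) (snd (edge_ends e)))\<^sup>2)"
  shows "c \<le> kth_eigenvalue (((d + 1) choose 2) + 1) (stiffness_matrix d (V, E) p)"
proof -
  let ?M = "stiffness_matrix d (V, E) p" and ?n = "d * card V" and ?k = "((d + 1) choose 2) + 1"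
  have M: "?M \<in> carrier_mat ?n ?n" using stiffness_matrix_carrier[of d "(V, E)" p] by simp
  have "finite (constraint ` ordered_pairs d)" "constraint ` ordered_pairs d \<subseteq> carrier_vec ?n"
    using constraint_carrier by auto
  moreover have "card (constraint ` ordered_pairs d) < ?k" using card_constraints by simp
  ultimately obtain x where x: "x \<in> carrier_vec ?n" "x \<noteq> 0\<^sub>v ?n"
    "\<And>f. f \<in> constraint ` ordered_pairs d \<Longrightarrow> f \<bullet> x = 0"
    "x \<bullet> (?M *\<^sub>v x) \<le> kth_eigenvalue ?k ?M * (x \<bullet> x)"
    using kth_eigenvalue_max_min[OF M stiffness_matrix_symmetric, of ?k "constraint ` ordered_pairs d"]
      choose_less_dimension by (metis Suc_eq_plus1 Suc_leI le_add2)
  obtain X where X: "x = config_vec d V X" using config_vec_exhaust[OF finite_V x(1)] .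
  have "balanced X" using x(3) unfolding X by (intro balancedI) blast
  then have "c * (x \<bullet> x) \<le> x \<bullet> (?M *\<^sub>v x)"
    using assms stiffness_quadratic_form[OF graph, of d X p]
    by (simp add: X config_vec_scalar_prod power2_eq_square)
  with x(4) have "c * (x \<bullet> x) \<le> kth_eigenvalue ?k ?M * (x \<bullet> x)" by linarith
  then show ?thesis using real_scalar_prod_self_pos[OF x(1,2)] by simp
qed

text \<open>Each tilted framework reaches \<open>c\<close> up to an arbitrarily small loss; the
  supremum over frameworks removes it.\<close>

lemma algebraic_connectivity_dim_ge:
  assumes c: "c \<ge> 0"
    and ind: "\<And>i. i < d \<Longrightarrow> ereal c \<le> algebraic_connectivity (induced (V, E) (part i))"
    and btw: "\<And>i j. i < j \<Longrightarrow> j < d \<Longrightarrow> ereal (2 * c) \<le> algebraic_connectivity (between (V, E) (part i) (part j))"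
  shows "ereal c \<le> algebraic_connectivity_dim d (V, E)"
proof (rule ereal_le_epsilon2)
  fix \<delta> :: real assume "\<delta> > 0"
  obtain s where s: "inj_on s V"
    "\<And>X. balanced X \<Longrightarrow> (c - \<delta>) * (\<Sum>v\<in>V. \<Sum>k<d. (X v k)\<^sup>2) \<le>
      (\<Sum>e\<in>E. (stretch d (tilted s) X (fst (edge_ends e)) (snd (edge_ends e)))\<^sup>2)"
    using stretch_form_tilted_ge[OF c ind btw \<open>\<delta> > 0\<close>] by blast
  have "ereal (c - \<delta>) \<le> ereal (kth_eigenvalue (((d + 1) choose 2) + 1) (stiffness_matrix d (V, E) (tilted s)))"
    using kth_eigenvalue_stiffness_ge[OF s(2)] by simp
  also have "\<dots> \<le> algebraic_connectivity_dim d (V, E)"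
    unfolding algebraic_connectivity_dim_def by (rule SUP_upper) simp
  finally show "ereal c \<le> algebraic_connectivity_dim d (V, E) + ereal \<delta>"
    by (cases "algebraic_connectivity_dim d (V, E)") auto
qed

section \<open>The rank of the tilted framework\<close>

text \<open>One vertex \<open>r i\<close> from each part is enough. The combination is an affine map
  with translation \<open>\<tau>\<close> and skew matrix \<open>S\<close>; its vanishing at e_i +
  t_i (1,...,1) reads \<open>\<tau> k + S k i + t i * \<rho> k = 0\<close>, where
  \<open>\<rho>\<close> holds the row sums of \<open>S\<close>. Once \<open>\<rho>\<close> is known
  to vanish, the case \<open>i = k\<close> kills \<open>\<tau>\<close> and the others kill
  \<open>S\<close>.\<close>

lemma trivial_motions_independent:
  assumes inj: "inj_on s V"
    and zero: "\<And>v k. v \<in> V \<Longrightarrow> k < d \<Longrightarrow>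
      (\<Sum>ab\<in>ordered_pairs d. trivial_motion (tilted s) ab v k * \<gamma> ab) = 0"
    and ab: "ab \<in> ordered_pairs d"
  shows "\<gamma> ab = 0"
proof -
  define S where "S a b = (if a < b then \<gamma> (a, b) else if b < a then - \<gamma> (b, a) else 0)" for a b
  define \<tau> where "\<tau> a = \<gamma> (a, a)" for a
  define \<rho> where "\<rho> a = (\<Sum>b<d. S a b)" for a
  have skew: "S a b = - S b a" for a b by (auto simp: S_def)
  have "\<exists>r. \<forall>i<d. r i \<in> V \<and> \<kappa> (r i) = i"
    using part_nonempty by (intro choice) blast
  then obtain r where r: "\<And>i. i < d \<Longrightarrow> r i \<in> V" "\<And>i. i < d \<Longrightarrow> \<kappa> (r i) = i" by blast
  define t where "t i = s (r i)" for i
  have t: "t i \<noteq> t j" if "i < d" "j < d" "i \<noteq> j" for i j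
    using that r inj unfolding t_def by (metis inj_onD)
  have eq: "\<tau> k + S k i + t i * \<rho> k = 0" if "k < d" "i < d" for k i
  proof -
    have "(\<Sum>b<d. S k b * tilted s (r i) $ b) = (\<Sum>b<d. (if b = i then S k b else 0) + t i * S k b)"
      using r(2)[OF that(2)] by (intro sum.cong) (auto simp: tilted_def t_def algebra_simps)
    also have "\<dots> = S k i + t i * \<rho> k"
      using that by (simp add: sum.distrib \<rho>_def sum_distrib_left)
    finally show ?thesis
      using zero[OF r(1)[OF that(2)] that(1)] sum_trivial_motion[OF that(1), of "tilted s" "r i" \<gamma>]
      by (simp add: S_def[symmetric] \<tau>_def)
  qed
  have diag: "\<tau> k = - t k * \<rho> k" if "k < d" for k
    using eq[OF that that] by (simp add: S_def)
  \<comment> \<open>Eliminating \<open>\<tau>\<close> and adding the equations for (k, i) and (i, k)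
    cancels the skew entries; distinct offsets then force equal row sums.\<close>
  have \<rho>_const: "\<rho> i = \<rho> k" if "i < d" "k < d" for i k
  proof (cases "i = k")
    case False
    have "(t i - t k) * (\<rho> k - \<rho> i) = 0"
      using eq[OF that(2,1)] eq[OF that] diag[OF that(1)] diag[OF that(2)] skew[of i k]
      by (simp add: algebra_simps)
    with t[OF that False] show ?thesis by simp
  qed simp
  \<comment> \<open>The entries of a skew-symmetric matrix sum to 0, so the common row sum is 0 as
    well.\<close>
  have "(\<Sum>a<d. \<rho> a) = 0"
  proof -
    have "(\<Sum>a<d. \<rho> a) = (\<Sum>b<d. \<Sum>a<d. S a b)" unfolding \<rho>_def by (rule sum.swap)
    also have "\<dots> = (\<Sum>b<d. \<Sum>a<d. - S b a)" by (intro sum.cong refl skew)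
    also have "\<dots> = - (\<Sum>a<d. \<rho> a)" by (simp add: \<rho>_def sum_negf)
    finally show ?thesis by simp
  qed
  moreover have "(\<Sum>a<d. \<rho> a) = real d * \<rho> k" if "k < d" for k
    using \<rho>_const[OF _ that] sum.cong[of "{..<d}" "{..<d}" \<rho> "\<lambda>_. \<rho> k"] by simp
  ultimately have \<rho>: "\<rho> k = 0" if "k < d" for k
    using that by (metis less_zeroE mult_eq_0_iff of_nat_eq_0_iff)
  then have \<tau>: "\<tau> k = 0" if "k < d" for k using diag that by simp
  have S: "S k i = 0" if "k < d" "i < d" for k i using eq[OF that] \<rho> \<tau> that by simp
  obtain a b where "ab = (a, b)" "a \<le> b" "b < d" using ab by (auto simp: ordered_pairs_def)
  then show ?thesis using \<tau>[of a] S[of a b] by (cases "a = b") (auto simp: \<tau>_def S_def)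
qed

text \<open>The trivial motions, as columns of \<open>Y\<close>, are independent vectors in the
  kernel of the transposed rigidity matrix.\<close>

lemma rank_rigidity_tilted_le:
  assumes inj: "inj_on s V"
  shows "vec_space.rank (d * card V) (rigidity_matrix d (V, E) (tilted s)) + ((d + 1) choose 2) \<le> d * card V"
proof -
  let ?I = "ordered_pairs d" and ?n = "d * card V"
  let ?R = "rigidity_matrix d (V, E) (tilted s)"
  let ?q = "card ?I" and ?is = "enumeration (ordered_pairs d)"
  have R: "?R \<in> carrier_mat ?n (card E)" using rigidity_matrix_carrier[of d "(V, E)"] by simp
  define Y where "Y = mat_of_cols ?n (map (\<lambda>ab. config_vec d V (trivial_motion (tilted s) ab)) ?is)"
  have len: "length ?is = ?q" using enumeration(3)[OF finite_ordered_pairs] .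
  have Y: "Y \<in> carrier_mat ?n ?q" unfolding Y_def using len by (simp add: mat_of_cols_def)
  have colY: "col Y l = config_vec d V (trivial_motion (tilted s) (?is ! l))" if "l < ?q" for l
    unfolding Y_def using that len by (subst col_mat_of_cols) auto
  have mem: "?is ! l \<in> ?I" if "l < ?q" for l
    using that len enumeration(2)[OF finite_ordered_pairs, of d] nth_mem by metis
  have "transpose_mat ?R * Y = 0\<^sub>m (card E) ?q"
  proof (rule eq_matI)
    fix t l assume tl: "t < dim_row (0\<^sub>m (card E) ?q :: real mat)" "l < dim_col (0\<^sub>m (card E) ?q :: real mat)"
    have "(transpose_mat ?R * Y) $$ (t, l) = (transpose_mat ?R *\<^sub>v col Y l) $ t"
      using tl R Y by simp
    also have "\<dots> = (case edge_ends (enumeration E ! t) of (u, v) \<Rightarrow>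
        stretch d (tilted s) (trivial_motion (tilted s) (?is ! l)) u v)"
      using rigidity_matrix_transpose_mult[OF graph, of t d "tilted s"] tl colY[of l] by simp
    also have "\<dots> = 0"
      using stretch_trivial_motion[of "tilted s" _ d _ "?is ! l"] mem[of l] tl by (simp add: case_prod_beta)
    finally show "(transpose_mat ?R * Y) $$ (t, l) = 0\<^sub>m (card E) ?q $$ (t, l)" using tl by simp
  qed (use R Y in auto)
  moreover have "c = 0\<^sub>v ?q" if c: "c \<in> carrier_vec ?q" and Yc: "Y *\<^sub>v c = 0\<^sub>v ?n" for c
  proof -
    \<comment> \<open>The coefficient vector is read as a function on the index pairs, so that
      \<open>Y *\<^sub>v c\<close> becomes a combination of trivial motions.\<close>
    obtain \<Gamma> where \<Gamma>: "c = config_vec 1 ?I \<Gamma>"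
      using config_vec_exhaust[OF finite_ordered_pairs, of c 1 d] c by auto
    define \<gamma> where "\<gamma> ab = \<Gamma> ab 0" for ab
    have "Y *\<^sub>v c = config_vec d V (\<lambda>v k. \<Sum>ab\<in>?I. trivial_motion (tilted s) ab v k * \<gamma> ab)"
    proof (rule eq_vecI)
      fix r assume "r < dim_vec (config_vec d V (\<lambda>v k. \<Sum>ab\<in>?I. trivial_motion (tilted s) ab v k * \<gamma> ab))"
      then have r: "r < ?n" by (simp add: config_vec_def)
      have "(Y *\<^sub>v c) $ r = (\<Sum>l<?q. Y $$ (r, l) * c $ l)"
        using r c Y by (auto simp: scalar_prod_def atLeast0LessThan intro!: sum.cong)
      also have "\<dots> = (\<Sum>l<?q. trivial_motion (tilted s) (?is ! l) (enumeration V ! (r div d)) (r mod d) * \<gamma> (?is ! l))"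
      proof (intro sum.cong arg_cong2[where f = "(*)"])
        fix l assume "l \<in> {..<?q}"
        then have l: "l < ?q" by simp
        have "Y $$ (r, l) = col Y l $ r" using r l Y by simp
        then show "Y $$ (r, l) = trivial_motion (tilted s) (?is ! l) (enumeration V ! (r div d)) (r mod d)"
          using r colY[OF l] by (simp add: config_vec_def)
        show "c $ l = \<gamma> (?is ! l)" using l by (simp add: \<Gamma> config_vec_def \<gamma>_def)
      qed simp
      also have "\<dots> = (\<Sum>ab\<in>?I. trivial_motion (tilted s) ab (enumeration V ! (r div d)) (r mod d) * \<gamma> ab)"
        by (rule sum_enumeration[OF finite_ordered_pairs])
      finally show "(Y *\<^sub>v c) $ r = config_vec d V (\<lambda>v k. \<Sum>ab\<in>?I. trivial_motion (tilted s) ab v k * \<gamma> ab) $ r"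
        using r by (simp add: config_vec_def)
    qed (use Y in \<open>simp add: config_vec_def\<close>)
    then have "config_vec d V (\<lambda>v k. \<Sum>ab\<in>?I. trivial_motion (tilted s) ab v k * \<gamma> ab) = 0\<^sub>v ?n"
      using Yc by simp
    then have "\<forall>v\<in>V. \<forall>k<d. (\<Sum>ab\<in>?I. trivial_motion (tilted s) ab v k * \<gamma> ab) = 0"
      unfolding config_vec_eq_0_iff[OF finite_V] .
    then have "\<gamma> ab = 0" if "ab \<in> ?I" for ab
      using trivial_motions_independent[OF inj _ that, of \<gamma>] by blast
    then have "config_vec 1 ?I \<Gamma> = 0\<^sub>v (1 * ?q)"
      by (subst config_vec_eq_0_iff) (auto simp: \<gamma>_def)
    then show ?thesis by (simp add: \<Gamma>)
  qed
  ultimately have "vec_space.rank ?n ?R + ?q \<le> ?n"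
    using rank_le_of_orthogonal_independent[OF R Y] by blast
  then show ?thesis by (simp add: card_ordered_pairs)
qed

text \<open>A balanced displacement that stretches no edge has stiffness form 0 and therefore
  vanishes by \<open>form\<close>. Thus the balance conditions cut the left kernel down to
  0.\<close>

lemma rank_rigidity_ge:
  assumes c: "c > 0"
    and form: "\<And>X. balanced X \<Longrightarrow> c * (\<Sum>v\<in>V. \<Sum>k<d. (X v k)\<^sup>2) \<le>
      (\<Sum>e\<in>E. (stretch d p X (fst (edge_ends e)) (snd (edge_ends e)))\<^sup>2)"
  shows "d * card V \<le> vec_space.rank (d * card V) (rigidity_matrix d (V, E) p) + ((d + 1) choose 2)"
proof -
  let ?n = "d * card V" and ?R = "rigidity_matrix d (V, E) p"
  have R: "?R \<in> carrier_mat ?n (card E)" using rigidity_matrix_carrier[of d "(V, E)"] by simp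
  have "x = 0\<^sub>v ?n" if x: "x \<in> carrier_vec ?n" "\<And>f. f \<in> constraint ` ordered_pairs d \<Longrightarrow> f \<bullet> x = 0"
    "transpose_mat ?R *\<^sub>v x = 0\<^sub>v (card E)" for x
  proof -
    obtain X where X: "x = config_vec d V X" using config_vec_exhaust[OF finite_V x(1)] .
    have "balanced X" using x(2) unfolding X by (intro balancedI) blast
    note form[OF this]
    also have "(\<Sum>e\<in>E. (stretch d p X (fst (edge_ends e)) (snd (edge_ends e)))\<^sup>2) =
        x \<bullet> (stiffness_matrix d (V, E) p *\<^sub>v x)"
      unfolding X using stiffness_quadratic_form[OF graph, of d X p] by simp
    also have "stiffness_matrix d (V, E) p *\<^sub>v x = ?R *\<^sub>v (transpose_mat ?R *\<^sub>v x)"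
      unfolding stiffness_matrix_def using R x(1) by (intro assoc_mult_mat_vec) auto
    also have "\<dots> = 0\<^sub>v ?n" unfolding x(3) using R by (intro eq_vecI) auto
    finally have "c * (x \<bullet> x) \<le> 0"
      using x(1) by (simp add: X config_vec_scalar_prod power2_eq_square)
    then show ?thesis
      using c real_scalar_prod_self_pos[OF x(1)] by (meson mult_pos_pos not_le)
  qed
  then have "?n \<le> vec_space.rank ?n ?R + card (constraint ` ordered_pairs d)"
    using constraint_carrier by (intro rank_ge_of_trivial_cokernel[OF R]) auto
  then show ?thesis using card_constraints by linarith
qed

lemma rigid_of_pos:
  assumes c: "c > 0"
    and ind: "\<And>i. i < d \<Longrightarrow> ereal c \<le> algebraic_connectivity (induced (V, E) (part i))"
    and btw: "\<And>i j. i < j \<Longrightarrow> j < d \<Longrightarrow> ereal (2 * c) \<le> algebraic_connectivity (between (V, E) (part i) (part j))"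
  shows "rigid d (V, E)"
proof -
  \<comment> \<open>Spending half of \<open>c\<close> on the tilt leaves a form bounded below by
    \<open>c / 2\<close>, which is positive definite on balanced displacements.\<close>
  have "c \<ge> 0" "c / 2 > 0" using c by auto
  then obtain s where s: "inj_on s V"
    "\<And>X. balanced X \<Longrightarrow> (c - c / 2) * (\<Sum>v\<in>V. \<Sum>k<d. (X v k)\<^sup>2) \<le>
      (\<Sum>e\<in>E. (stretch d (tilted s) X (fst (edge_ends e)) (snd (edge_ends e)))\<^sup>2)"
    using stretch_form_tilted_ge[OF _ ind btw, of "c / 2"] by blast
  have "d * card V = vec_space.rank (d * card V) (rigidity_matrix d (V, E) (tilted s)) + ((d + 1) choose 2)"
    using rank_rigidity_tilted_le[OF s(1)] rank_rigidity_ge[OF _ s(2)] c by simp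
  then have "int (vec_space.rank (d * card V) (rigidity_matrix d (V, E) (tilted s))) =
      int (d * card V) - int ((d + 1) choose 2)" by linarith
  then show ?thesis unfolding rigid_def by (intro exI[of _ "tilted s"]) auto
qed

end

theorem theorem1p3:
  fixes d :: nat and V :: "'a set" and E :: "'a set set" and A :: "nat \<Rightarrow> 'a set"
  assumes "d \<ge> 2"
    and "finite_simple_graph (V, E)"
    and "V = (\<Union>i\<in>{1..d}. A i)"
    and "disjoint_family_on A {1..d}"
    and "\<forall>i\<in>{1..d}. A i \<noteq> {}"
  shows "algebraic_connectivity_dim d (V, E) \<ge>
      Min ({algebraic_connectivity (induced (V, E) (A i)) | i. 1 \<le> i \<and> i \<le> d} \<union>
           {ereal (1 / 2) * algebraic_connectivity (between (V, E) (A i) (A j)) | i j.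
              1 \<le> i \<and> i < j \<and> j \<le> d})
    \<and> ((\<forall>i. 1 \<le> i \<and> i \<le> d \<longrightarrow> graph_connected (induced (V, E) (A i))) \<and>
       (\<forall>i j. 1 \<le> i \<and> i < j \<and> j \<le> d \<longrightarrow> graph_connected (between (V, E) (A i) (A j)))
       \<longrightarrow> rigid d (V, E))"
proof -
  \<comment> \<open>The parts A_1, ..., A_d receive the colors 0, ..., d - 1; this shift explains
    the \<open>Suc\<close> below.\<close>
  define \<kappa> where "\<kappa> v = (THE i. i < d \<and> v \<in> A (Suc i))" for v
  have \<kappa>_eq: "\<kappa> v = i" if "i < d" "v \<in> A (Suc i)" for v i
    unfolding \<kappa>_def
  proof (rule the_equality)
    fix j assume j: "j < d \<and> v \<in> A (Suc j)"
    show "j = i"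
    proof (rule ccontr)
      assume "j \<noteq> i"
      then have "A (Suc i) \<inter> A (Suc j) = {}"
        using assms(4) j that by (intro disjoint_family_onD) auto
      then show False using j that by blast
    qed
  qed (use that in simp)
  have ex: "\<exists>i<d. v \<in> A (Suc i)" if v: "v \<in> V" for v
  proof -
    obtain i where "1 \<le> i" "i \<le> d" "v \<in> A i" using v assms(3) by auto
    then show ?thesis by (intro exI[of _ "i - 1"]) auto
  qed
  have AV: "A (Suc i) \<subseteq> V" if "i < d" for i using that assms(3) by auto
  have part: "{v \<in> V. \<kappa> v = i} = A (Suc i)" if "i < d" for i
    using ex \<kappa>_eq AV[OF that] that by blast
  interpret partitioned_graph d V E \<kappa>
  proof
    show "\<kappa> ` V = {..<d}"
    proof (intro equalityI subsetI)
      fix i assume "i \<in> \<kappa> ` V"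
      then show "i \<in> {..<d}" using ex \<kappa>_eq by fastforce
    next
      fix i assume "i \<in> {..<d}"
      then have i: "i < d" by simp
      have "A (Suc i) \<noteq> {}" using assms(5) i by auto
      then obtain x where "x \<in> A (Suc i)" by blast
      then have "x \<in> {v \<in> V. \<kappa> v = i}" using part[OF i] by simp
      then show "i \<in> \<kappa> ` V" by blast
    qed
  qed (use assms in auto)
  let ?I = "{1..d}" and ?P = "{(i, j). 1 \<le> i \<and> i < j \<and> j \<le> d}"
  let ?f = "\<lambda>i. algebraic_connectivity (induced (V, E) (A i))"
  let ?g = "\<lambda>(i, j). ereal (1 / 2) * algebraic_connectivity (between (V, E) (A i) (A j))"
  define M where "M = ?f ` ?I \<union> ?g ` ?P"
  have M_eq: "{algebraic_connectivity (induced (V, E) (A i)) | i. 1 \<le> i \<and> i \<le> d} \<union>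
      {ereal (1 / 2) * algebraic_connectivity (between (V, E) (A i) (A j)) | i j.
         1 \<le> i \<and> i < j \<and> j \<le> d} = M"
    unfolding M_def by (intro arg_cong2[where f = "(\<union>)"]) auto
  have finP: "finite ?P" by (rule finite_subset[of _ "{..d} \<times> {..d}"]) auto
  have finM: "finite M" using finP by (simp add: M_def)
  have neM: "M \<noteq> {}" using assms(1) by (auto simp: M_def)
  have indA: "finite_simple_graph (induced (V, E) (A i)) \<and> fst (induced (V, E) (A i)) \<noteq> {}"
    if "1 \<le> i" "i \<le> d" for i
    using induced_graph[of "i - 1"] part[of "i - 1"] assms(5) that by (auto simp: induced_def)
  have btwA: "finite_simple_graph (between (V, E) (A i) (A j)) \<and> fst (between (V, E) (A i) (A j)) \<noteq> {}"
    if "1 \<le> i" "i < j" "j \<le> d" for i j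
    using between_graph[of "i - 1" "j - 1"] part[of "i - 1"] part[of "j - 1"] assms(5) that
    by (auto simp: between_def)
  have nonneg: "0 \<le> m" if m: "m \<in> M" for m
  proof -
    consider i where "m = ?f i" "1 \<le> i" "i \<le> d" | i j where "m = ?g (i, j)" "1 \<le> i" "i < j" "j \<le> d"
      using m unfolding M_def by auto
    then show ?thesis
    proof cases
      case (1 i)
      then show ?thesis using algebraic_connectivity_nonneg indA by blast
    next
      case (2 i j)
      then have "algebraic_connectivity (between (V, E) (A i) (A j)) \<ge> 0"
        using algebraic_connectivity_nonneg btwA by blast
      then show ?thesis using 2 by simp
    qed
  qed
  \<comment> \<open>Parts with one vertex contribute infinity, but since \<open>d \<ge> 2\<close>
    some pair of parts exists, and its graph has at least two vertices. So the minimum is a real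
    number.\<close>
  have "Min M < \<infinity>"
  proof -
    have "(1, 2) \<in> ?P" using assms(1) by simp
    then have mem: "?g (1, 2) \<in> M" unfolding M_def by blast
    have "card (A 1 \<union> A 2) \<noteq> 1"
    proof
      assume "card (A 1 \<union> A 2) = 1"
      then obtain x where x: "A 1 \<union> A 2 = {x}" by (auto simp: card_1_singleton_iff)
      have "A 1 \<noteq> {}" "A 2 \<noteq> {}" using assms(1,5) by auto
      with x have "A 1 = {x}" "A 2 = {x}" by (metis Un_singleton_iff)+
      moreover have "A 1 \<inter> A 2 = {}" using assms(1,4) by (intro disjoint_family_onD) auto
      ultimately show False by simp
    qed
    then have "?g (1, 2) < \<infinity>" by (simp add: algebraic_connectivity_def between_def)
    then show ?thesis by (rule le_less_trans[OF Min_le[OF finM mem]])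
  qed
  \<comment> \<open>The sign matters because \<open>limit_form_ge\<close> multiplies the estimate at
    each vertex by \<open>c\<close>.\<close>
  moreover have "0 \<le> Min M" using finM neM nonneg by simp
  ultimately obtain c where c: "Min M = ereal c" "c \<ge> 0"
    by (cases "Min M") auto
  have le: "ereal c \<le> m" if "m \<in> M" for m using Min_le[OF finM that] c(1) by simp
  have ind: "ereal c \<le> algebraic_connectivity (induced (V, E) {v \<in> V. \<kappa> v = i})" if "i < d" for i
    using le[of "?f (Suc i)"] that unfolding part[OF that] M_def by auto
  have btw: "ereal (2 * c) \<le> algebraic_connectivity (between (V, E) {v \<in> V. \<kappa> v = i} {v \<in> V. \<kappa> v = j})"
    if "i < j" "j < d" for i j
  proof -
    let ?a = "algebraic_connectivity (between (V, E) (A (Suc i)) (A (Suc j)))"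
    have "(Suc i, Suc j) \<in> ?P" using that by simp
    then have "?g (Suc i, Suc j) \<in> M" unfolding M_def by blast
    then have "ereal c \<le> ereal (1 / 2) * ?a" using le by fastforce
    then have "ereal (2 * c) \<le> ?a" by (cases ?a) auto
    then show ?thesis using part[of i] part[of j] that by simp
  qed
  have "Min M \<le> algebraic_connectivity_dim d (V, E)"
    unfolding c(1) by (rule algebraic_connectivity_dim_ge[OF c(2) ind btw])
  moreover have "rigid d (V, E)"
    if conn: "\<And>i. 1 \<le> i \<Longrightarrow> i \<le> d \<Longrightarrow> graph_connected (induced (V, E) (A i))"
      "\<And>i j. 1 \<le> i \<Longrightarrow> i < j \<Longrightarrow> j \<le> d \<Longrightarrow> graph_connected (between (V, E) (A i) (A j))"
  proof -
    have "0 < m" if m: "m \<in> M" for m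
    proof -
      consider i where "m = ?f i" "1 \<le> i" "i \<le> d" | i j where "m = ?g (i, j)" "1 \<le> i" "i < j" "j \<le> d"
        using m unfolding M_def by auto
      then show ?thesis
      proof cases
        case (1 i)
        then show ?thesis using algebraic_connectivity_pos indA conn(1) by blast
      next
        case (2 i j)
        then have "algebraic_connectivity (between (V, E) (A i) (A j)) > 0"
          using algebraic_connectivity_pos btwA conn(2) by blast
        then show ?thesis using 2 by (simp add: ereal_zero_less_0_iff)
      qed
    qed
    then have "0 < Min M" using finM neM by simp
    then have "c > 0" using c(1) by simp
    then show ?thesis by (rule rigid_of_pos[OF _ ind btw])
  qed
  ultimately show ?thesis unfolding M_eq by blast
qed

end
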